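(* Let $\pi\in\mathcal{A}^*$ and let $(\tilde{P},P^t,L)$ be the image of $\pi$ under the dual $spo$-correspondence. Then $\tilde{P}$ is an $spo(2m,n)$-tableau of some shape $\lambda$, $P^t$ is a semistandard tableau (of shape $\lambda^t$, with entries in $\{1,\dots,q\}$), and $L$ is a dual Burge two-line array.
   Context: Fix positive integers $m,n,q$. Let $B_0=\{1,\overline{1},\dots,m,\overline{m}\}$ and $B_1=\{1^\circ,\dots,n^\circ\}$, totally ordered by $1<\overline{1}<2<\overline{2}<\cdots<m<\overline{m}<1^\circ<\cdots<n^\circ$. Young diagrams are drawn with row $1$ on top. A tableau is semistandard if rows weakly increase left to right and columns strictly increase top to bottom; $P^t$ denotes the transpose of a tableau $P$. An $spo(2m,n)$-tableau of shape $\lambda$ is a filling of the Young diagram of $\lambda$ with entries of $B_0\cup B_1$ such that the boxes with entries in $B_0$ form a Young diagram of a shape $\mu\subseteq\lambda$ on which entries weakly increase along rows, strictly increase down columns, and every entry in row $i$ is $\geq i$ (no $j$ or $\overline{j}$ with $j<i$ in row $i$); and the entries of $B_1$ in $\lambda/\mu$ strictly increase along rows and weakly increase down columns. Forward slide: for a filling with one empty box, with $x$ the entry immediately to its right and $y$ the entry immediately below; if only one exists it moves in; otherwise $x$ moves left if $x<y$ or $x=y\in B_1$, and $y$ moves up if $y<x$ or $x=y\in B_0$. Repeat until the empty box is at an outer corner, and delete that box. $spo$-insertion $T\leftarrow x$: insert $z=x$ into row 1; to insert $z$ into row $r$: if $z\in B_0$ and $z\geq$ all entries of row $r$, or $z\in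 B_1$ and $z>$ all entries of row $r$ (including an empty row below the tableau), append $z$ at the end of row $r$ and stop; otherwise let $z'$ be the leftmost entry of row $r$ with $z'\geq z$ (if $z\in B_1$) or with $z'>z$ (if $z\in B_0$), replace $z'$ by $z$ and insert $z'$ into row $r+1$. If at some stage an $i\in\{1,\dots,m\}$ inserted into row $i$ would bump an $\overline{i}$ out of row $i$ (a cancellation), then at the first such stage the $\overline{i}$ is removed instead (and $i$ not placed) and forward slides move the empty box to an outer corner, where it is deleted. Thus $T\leftarrow x$ has one box more or one box fewer than $T$. $\mathcal{A}^*$ is the set of two-line arrays $\pi=\begin{pmatrix}a_1&\cdots&a_s\\ b_1&\cdots&b_s\end{pmatrix}$ with $a_i\in\{1,\dots,q\}$, $b_i\in B_0\cup B_1$, such that $a_i\leq a_{i+1}$, $a_i=a_{i+1}$ implies $b_i\geq b_{i+1}$, and each column $\binom{i}{j}$ with $j\in B_0$ occurs at most once. A dual Burge two-line array is an array $\begin{pmatrix}i_1&\cdots&i_r\\ j_1&\cdots&j_r\end{pmatrix}$ with $i_k,j_k\in\{1,\dots,q\}$, $i_k\leq i_{k+1}$, $i_k=i_{k+1}\Rightarrow j_k\geq j_{k+1}$, and $i_k\geq j_k$ for all $k$. The dual $spo$-correspondence: set $\tilde{P}_0=P_0=L_0=\emptyset$. For $k=1,\dots,s$, with $k$-th column $\binom{i}{j}$ of $\pi$, let $\tilde{P}_k=\tilde{P}_{k-1}\leftarrow j$. If a box was added, form $P_k$ by adding a box containing $i$ to $P_{k-1}$ in the position of the new box of $\tilde{P}_k$,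 and set $L_k=L_{k-1}$. If a box was removed, consider the box of $P_{k-1}$ in the position of the box of $\tilde{P}_{k-1}$ missing from $\tilde{P}_k$ and perform reverse dual row insertion: remove that box and move its entry $x$ into the row above, where it replaces the largest entry $x'$ of that row with $x'\leq x$; then $x'$ is moved into the row above it by the same rule, and so on until an entry $a$ is bumped out of the first row; let $P_k$ be the result and let $L_k$ be $L_{k-1}$ with column $\binom{i}{a}$ appended on the right. Finally $\tilde{P}=\tilde{P}_s$, $P=P_s$, and $L$ is obtained from $L_s$ by reordering, within each maximal block of columns with equal top entries, the bottom entries into weakly decreasing order. *)

theory Defs
  imports Main
begin

section \<open>The alphabet\<close>

text \<open>
  \<open>Plain i\<close>, \<open>Bar i\<close> and \<open>Circ i\<close> stand for $i$, $\overline{i}$ and $i^\circ$. The type does not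
  bound the indices; \<open>B0 m\<close> and \<open>B1 n\<close> are the finite alphabets $B_0$ and $B_1$. On letters of
  \<open>B0 m \<union> B1 n\<close>, membership in $B_1$ is decided by the constructor, i.e. by \<open>is_Circ\<close>.
\<close>

datatype letter = Plain nat | Bar nat | is_Circ: Circ nat

definition B0 :: "nat \<Rightarrow> letter set" where
  "B0 m = Plain ` {1..m} \<union> Bar ` {1..m}"

definition B1 :: "nat \<Rightarrow> letter set" where
  "B1 n = Circ ` {1..n}"

fun letter_key :: "letter \<Rightarrow> nat \<times> nat" where
  "letter_key (Plain i) = (0, 2 * i)"
| "letter_key (Bar i) = (0, 2 * i + 1)"
| "letter_key (Circ i) = (1, i)"

text \<open>The order $1 < \overline{1} < 2 < \overline{2} < \cdots < 1^\circ < 2^\circ < \cdots$ is the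
  lexicographic order of the keys.\<close>

instantiation letter :: linorder
begin

definition less_letter :: "letter \<Rightarrow> letter \<Rightarrow> bool" where
  "a < b \<longleftrightarrow> fst (letter_key a) < fst (letter_key b) \<or>
     fst (letter_key a) = fst (letter_key b) \<and> snd (letter_key a) < snd (letter_key b)"

definition less_eq_letter :: "letter \<Rightarrow> letter \<Rightarrow> bool" where
  "a \<le> b \<longleftrightarrow> a < b \<or> a = (b :: letter)"

instance
proof
  fix x y z :: letter
  show "(x < y) = (x \<le> y \<and> \<not> y \<le> x)"
    by (auto simp: less_letter_def less_eq_letter_def)
  show "x \<le> x"
    by (simp add: less_eq_letter_def)
  show "x \<le> y \<Longrightarrow> y \<le> z \<Longrightarrow> x \<le> z"
    by (auto simp: less_letter_def less_eq_letter_def)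
  show "x \<le> y \<Longrightarrow> y \<le> x \<Longrightarrow> x = y"
    by (auto simp: less_letter_def less_eq_letter_def)
  show "x \<le> y \<or> y \<le> x"
    by (cases x; cases y) (auto simp: less_letter_def less_eq_letter_def, presburger+)
qed

end

section \<open>Shapes and fillings\<close>

text \<open>A box is a pair (row, column), both counted from 1, row 1 being on top.\<close>

type_synonym box = "nat \<times> nat"

type_synonym 'a filling = "box \<rightharpoonup> 'a"

definition is_partition :: "nat list \<Rightarrow> bool" where
  "is_partition lam \<longleftrightarrow> sorted_wrt (\<ge>) lam \<and> (\<forall>p\<in>set lam. 0 < p)"

definition diagram :: "nat list \<Rightarrow> box set" where
  "diagram lam = {(r, c). 1 \<le> r \<and> r \<le> length lam \<and> 1 \<le> c \<and> c \<le> lam ! (r - 1)}"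

definition conjugate :: "nat list \<Rightarrow> nat list" where
  "conjugate lam = map (\<lambda>c. length (filter (\<lambda>p. c \<le> p) lam)) [1..<Suc (foldr max lam 0)]"

definition transpose_filling :: "'a filling \<Rightarrow> 'a filling" where
  "transpose_filling T = (\<lambda>(r, c). T (c, r))"

definition along_rows :: "('a \<Rightarrow> 'a \<Rightarrow> bool) \<Rightarrow> 'a filling \<Rightarrow> box set \<Rightarrow> bool" where
  "along_rows R T D \<longleftrightarrow>
     (\<forall>r c c'. (r, c) \<in> D \<and> (r, c') \<in> D \<and> c < c' \<longrightarrow> R (the (T (r, c))) (the (T (r, c'))))"

definition down_columns :: "('a \<Rightarrow> 'a \<Rightarrow> bool) \<Rightarrow> 'a filling \<Rightarrow> box set \<Rightarrow> bool" where
  "down_columns R T D \<longleftrightarrow>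
     (\<forall>r r' c. (r, c) \<in> D \<and> (r', c) \<in> D \<and> r < r' \<longrightarrow> R (the (T (r, c))) (the (T (r', c))))"

definition semistandard_tableau :: "nat list \<Rightarrow> nat filling \<Rightarrow> bool" where
  "semistandard_tableau lam T \<longleftrightarrow>
     is_partition lam \<and> dom T = diagram lam \<and>
     along_rows (\<le>) T (dom T) \<and> down_columns (<) T (dom T)"

definition spo_tableau :: "nat \<Rightarrow> nat \<Rightarrow> nat list \<Rightarrow> letter filling \<Rightarrow> bool" where
  "spo_tableau m n lam T \<longleftrightarrow>
     is_partition lam \<and> dom T = diagram lam \<and> ran T \<subseteq> B0 m \<union> B1 n \<and>
     (\<exists>mu. is_partition mu \<and> diagram mu \<subseteq> diagram lam \<and>
        diagram mu = {b \<in> dom T. the (T b) \<in> B0 m} \<and>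
        along_rows (\<le>) T (diagram mu) \<and> down_columns (<) T (diagram mu) \<and>
        (\<forall>(r, c) \<in> diagram mu. Plain r \<le> the (T (r, c))) \<and>
        along_rows (<) T (diagram lam - diagram mu) \<and>
        down_columns (\<le>) T (diagram lam - diagram mu))"

section \<open>Forward slides and insertion\<close>

definition row :: "'a filling \<Rightarrow> nat \<Rightarrow> 'a set" where
  "row T r = {x. \<exists>c. T (r, c) = Some x}"

definition row_length :: "'a filling \<Rightarrow> nat \<Rightarrow> nat" where
  "row_length T r = card {c. (r, c) \<in> dom T}"

text \<open>\<open>forward_slide T r c\<close> moves the empty box \<open>(r, c) \<notin> dom T\<close> to an outer corner. An empty
  box is never in the domain, so deleting it at the end requires no change.
  The tail-recursive definitions below terminate on finite fillings.\<close>

partial_function (tailrec) forward_slide :: "letter filling \<Rightarrow> nat \<Rightarrow> nat \<Rightarrow> letter filling" where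
  "forward_slide T r c =
     (case T (r, c + 1) of
        None \<Rightarrow>
          (case T (r + 1, c) of
             None \<Rightarrow> T
           | Some y \<Rightarrow> forward_slide (T((r, c) \<mapsto> y, (r + 1, c) := None)) (r + 1) c)
      | Some x \<Rightarrow>
          (case T (r + 1, c) of
             None \<Rightarrow> forward_slide (T((r, c) \<mapsto> x, (r, c + 1) := None)) r (c + 1)
           | Some y \<Rightarrow>
               (if x < y \<or> x = y \<and> is_Circ x
                then forward_slide (T((r, c) \<mapsto> x, (r, c + 1) := None)) r (c + 1)
                else forward_slide (T((r, c) \<mapsto> y, (r + 1, c) := None)) (r + 1) c)))"

definition appendable :: "letter \<Rightarrow> letter set \<Rightarrow> bool" where
  "appendable z R \<longleftrightarrow> (if is_Circ z then \<forall>y\<in>R. y < z else \<forall>y\<in>R. y \<le> z)"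

definition bump_column :: "letter filling \<Rightarrow> nat \<Rightarrow> letter \<Rightarrow> nat" where
  "bump_column T r z =
     (LEAST c. \<exists>y. T (r, c) = Some y \<and> (if is_Circ z then z \<le> y else z < y))"

partial_function (tailrec) insert_into_row ::
  "letter filling \<Rightarrow> nat \<Rightarrow> letter \<Rightarrow> letter filling" where
  "insert_into_row T r z =
     (if appendable z (row T r) then T((r, row_length T r + 1) \<mapsto> z)
      else
        (let c = bump_column T r z; z' = the (T (r, c)) in
         if z = Plain r \<and> z' = Bar r then forward_slide (T((r, c) := None)) r c
         else insert_into_row (T((r, c) \<mapsto> z)) (r + 1) z'))"

definition spo_insert :: "letter filling \<Rightarrow> letter \<Rightarrow> letter filling" where
  "spo_insert T x = insert_into_row T 1 x"

text \<open>\<open>reverse_bump P r x\<close> moves \<open>x\<close> into row \<open>r\<close> and continues upwards; row 0 means that \<open>x\<close> has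
  left the first row. The result consists of the new filling and the entry bumped out. The rows are
  strictly increasing when this is used, so an entry determines its column.\<close>

fun reverse_bump :: "nat filling \<Rightarrow> nat \<Rightarrow> nat \<Rightarrow> nat filling \<times> nat" where
  "reverse_bump P 0 x = (P, x)"
| "reverse_bump P (Suc r) x =
     (let x' = Max {y \<in> row P (Suc r). y \<le> x}; c = (THE c. P (Suc r, c) = Some x') in
      reverse_bump (P((Suc r, c) \<mapsto> x)) r x')"

definition reverse_dual_row_insert :: "nat filling \<Rightarrow> box \<Rightarrow> nat filling \<times> nat" where
  "reverse_dual_row_insert P b = reverse_bump (P(b := None)) (fst b - 1) (the (P b))"

section \<open>Two-line arrays and the dual correspondence\<close>

text \<open>A two-line array is the list of its columns, each a pair (top entry, bottom entry).\<close>

definition two_line_arrays :: "nat \<Rightarrow> nat \<Rightarrow> nat \<Rightarrow> (nat \<times> letter) list set" where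
  "two_line_arrays m n q =
     {w. (\<forall>(a, b) \<in> set w. a \<in> {1..q} \<and> b \<in> B0 m \<union> B1 n) \<and>
         (\<forall>k. Suc k < length w \<longrightarrow>
            fst (w ! k) \<le> fst (w ! Suc k) \<and>
            (fst (w ! k) = fst (w ! Suc k) \<longrightarrow> snd (w ! k) \<ge> snd (w ! Suc k))) \<and>
         (\<forall>i. \<forall>j \<in> B0 m. count_list w (i, j) \<le> 1)}"

definition dual_Burge :: "nat \<Rightarrow> (nat \<times> nat) list \<Rightarrow> bool" where
  "dual_Burge q L \<longleftrightarrow>
     (\<forall>(i, j) \<in> set L. i \<in> {1..q} \<and> j \<in> {1..q} \<and> i \<ge> j) \<and>
     (\<forall>k. Suc k < length L \<longrightarrow>
        fst (L ! k) \<le> fst (L ! Suc k) \<and>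
        (fst (L ! k) = fst (L ! Suc k) \<longrightarrow> snd (L ! k) \<ge> snd (L ! Suc k)))"

fun correspondence_step ::
  "nat \<times> letter \<Rightarrow> letter filling \<times> nat filling \<times> (nat \<times> nat) list
     \<Rightarrow> letter filling \<times> nat filling \<times> (nat \<times> nat) list" where
  "correspondence_step (i, j) (Pt, P, L) =
     (let Pt' = spo_insert Pt j in
      if dom Pt \<subset> dom Pt' then (Pt', P(the_elem (dom Pt' - dom Pt) \<mapsto> i), L)
      else
        (let (P', a) = reverse_dual_row_insert P (the_elem (dom Pt - dom Pt')) in
         (Pt', P', L @ [(i, a)])))"

function reorder_blocks :: "(nat \<times> nat) list \<Rightarrow> (nat \<times> nat) list" where
  "reorder_blocks [] = []"
| "reorder_blocks (p # L) =
     map (Pair (fst p)) (rev (sort (map snd (takeWhile (\<lambda>u. fst u = fst p) (p # L)))))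
     @ reorder_blocks (dropWhile (\<lambda>u. fst u = fst p) (p # L))"
  by pat_completeness auto
termination
  by (relation "measure length") (auto simp: le_imp_less_Suc length_dropWhile_le)

definition dual_spo_correspondence ::
  "(nat \<times> letter) list \<Rightarrow> letter filling \<times> nat filling \<times> (nat \<times> nat) list" where
  "dual_spo_correspondence w =
     (let (Pt, P, L) = fold correspondence_step w (Map.empty, Map.empty, [])
      in (Pt, transpose_filling P, reorder_blocks L))"

end

theory Submission
  imports Defs
begin

text \<open>
  Insertion and forward slides keep all order conditions, and the condition on row $i$ survives
  bumping because the only letter of row $i$ that may not enter row $i+1$ and can be bumped is
  $\overline{i}$, which is exactly the cancellation. For the recording filling, take two consecutive
  columns with the same top entry. The bumping path of the second letter stays weakly to the left of
  the first one and carries smaller letters. Hence, if both insertions add a box, the second box is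
  in a strictly lower row; and if the first insertion cancels, the second cancels in a higher row. So
  within a block of equal top entries all additions precede all cancellations, and equal entries are
  recorded in distinct rows. Reverse dual row insertion preserves strict rows and weak columns, and
  the entry bumped out is at most the current top entry.
\<close>

section \<open>Row and column order\<close>

text \<open>The two alphabets treat equal letters in opposite ways, and handling them apart would
  double every argument. The relations \<open>row_ok\<close> and \<open>col_ok\<close> absorb the
  difference: both are transitive, each is the negation of the other with the arguments exchanged,
  and a chain that uses both is strict. Appending, bumping and sliding then each test one of these
  relations, so insertion needs no split by alphabet apart from the cancelling pair
  \<open>Plain r\<close>, \<open>Bar r\<close>; the inner shape is read off only at the end.
  Together with the weak decrease inside a block, the multiplicity condition on arrays says that
  each bottom letter stands in \<open>col_ok\<close> to its predecessor. Comparing consecutive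
  columns is enough: one only has to remember that all recorded copies of the current top entry lie
  in rows up to that of the last added box.\<close>

definition row_ok :: "letter \<Rightarrow> letter \<Rightarrow> bool" where
  "row_ok a b \<longleftrightarrow> a < b \<or> a = b \<and> \<not> is_Circ a"

definition col_ok :: "letter \<Rightarrow> letter \<Rightarrow> bool" where
  "col_ok a b \<longleftrightarrow> a < b \<or> a = b \<and> is_Circ a"

lemma not_row_ok: "\<not> row_ok a b \<longleftrightarrow> col_ok b a"
  by (auto simp: row_ok_def col_ok_def)

lemma row_ok_trans: "row_ok a b \<Longrightarrow> row_ok b c \<Longrightarrow> row_ok a c"
  by (auto simp: row_ok_def)

lemma col_ok_trans: "col_ok a b \<Longrightarrow> col_ok b c \<Longrightarrow> col_ok a c"
  by (auto simp: col_ok_def)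

text \<open>Equality throughout would make the middle letter both a \<open>Circ\<close> and not one.
  Comparing two boxes around a corner thus gives a strict inequality, usable as a row and as a
  column condition.\<close>

lemma row_col_less: "row_ok a b \<Longrightarrow> col_ok b c \<Longrightarrow> a < c"
  by (auto simp: row_ok_def col_ok_def)

lemma col_row_less: "col_ok a b \<Longrightarrow> row_ok b c \<Longrightarrow> a < c"
  by (auto simp: row_ok_def col_ok_def)

lemma less_row_ok: "a < b \<Longrightarrow> row_ok a b" and less_col_ok: "a < b \<Longrightarrow> col_ok a b"
  by (auto simp: row_ok_def col_ok_def)

lemma row_ok_le: "row_ok a b \<Longrightarrow> a \<le> b" and col_ok_le: "col_ok a b \<Longrightarrow> a \<le> b"
  by (auto simp: row_ok_def col_ok_def)

lemma appendable_iff: "appendable z R \<longleftrightarrow> (\<forall>y\<in>R. row_ok y z)"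
  by (auto simp: appendable_def row_ok_def order.order_iff_strict)

lemma bump_column_eq: "bump_column T r z = (LEAST c. \<exists>y. T (r, c) = Some y \<and> col_ok z y)"
  unfolding bump_column_def col_ok_def
  by (rule arg_cong[where f = Least]) (auto simp: fun_eq_iff order.order_iff_strict)

lemma bump_columnE:
  assumes "\<not> appendable z (row T r)"
  obtains z' where "T (r, bump_column T r z) = Some z'" "col_ok z z'"
proof -
  from assms obtain c y where "T (r, c) = Some y" "col_ok z y"
    by (auto simp: appendable_iff row_def not_row_ok)
  then have "\<exists>c y. T (r, c) = Some y \<and> col_ok z y" by blast
  from LeastI_ex[OF this] show ?thesis
    using that by (auto simp: bump_column_eq)
qed

lemma bump_column_le: "T (r, c) = Some y \<Longrightarrow> col_ok z y \<Longrightarrow> bump_column T r z \<le> c"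
  unfolding bump_column_eq by (rule Least_le) auto

lemma bump_column_left: "T (r, c) = Some y \<Longrightarrow> c < bump_column T r z \<Longrightarrow> row_ok y z"
  using bump_column_le[of T r c y z] by (auto simp: not_row_ok[symmetric])

section \<open>Young diagrams and fillings\<close>

text \<open>Shapes are sets of boxes closed towards the upper left, so that adding or removing a
  corner is plain set manipulation; partitions are extracted only at the end.\<close>

definition young :: "box set \<Rightarrow> bool" where
  "young D \<longleftrightarrow> finite D \<and> (\<forall>(r, c)\<in>D. 1 \<le> r \<and> 1 \<le> c) \<and>
     (\<forall>r c r' c'. (r, c) \<in> D \<longrightarrow> 1 \<le> r' \<longrightarrow> r' \<le> r \<longrightarrow> 1 \<le> c' \<longrightarrow> c' \<le> c \<longrightarrow> (r', c') \<in> D)"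

lemma young_finite: "young D \<Longrightarrow> finite D"
  by (simp add: young_def)

lemma young_pos: "young D \<Longrightarrow> (r, c) \<in> D \<Longrightarrow> 1 \<le> r \<and> 1 \<le> c"
  by (auto simp: young_def)

lemma young_down:
  "young D \<Longrightarrow> (r, c) \<in> D \<Longrightarrow> 1 \<le> r' \<Longrightarrow> r' \<le> r \<Longrightarrow> 1 \<le> c' \<Longrightarrow> c' \<le> c \<Longrightarrow> (r', c') \<in> D"
  unfolding young_def by blast

lemma down_closed_interval:
  fixes C :: "nat set"
  assumes "finite C" "0 \<notin> C" "\<And>c c'. c \<in> C \<Longrightarrow> 1 \<le> c' \<Longrightarrow> c' \<le> c \<Longrightarrow> c' \<in> C"
  shows "C = {1..card C}"
proof (cases "C = {}")
  case False
  have "C = {1..Max C}"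
  proof (intro set_eqI iffI)
    fix c assume "c \<in> C"
    with assms show "c \<in> {1..Max C}" by (cases c) auto
  next
    fix c assume "c \<in> {1..Max C}"
    with assms False Max_in show "c \<in> C" by (metis atLeastAtMost_iff)
  qed
  then show ?thesis by (metis card_atLeastAtMost diff_Suc_1)
qed simp

lemma young_row_card:
  assumes "young D"
  shows "(r, c) \<in> D \<longleftrightarrow> 1 \<le> c \<and> c \<le> card {c. (r, c) \<in> D}"
proof -
  have "{c. (r, c) \<in> D} = {1..card {c. (r, c) \<in> D}}"
  proof (rule down_closed_interval)
    have "finite (snd ` D)" using assms by (simp add: young_finite)
    then show "finite {c. (r, c) \<in> D}"
      by (rule rev_finite_subset) (force simp: image_iff)
  next
    show "0 \<notin> {c. (r, c) \<in> D}" using young_pos[OF assms, of r 0] by auto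
  next
    fix c c' assume "c \<in> {c. (r, c) \<in> D}" "1 \<le> c'" "c' \<le> c"
    then show "c' \<in> {c. (r, c) \<in> D}"
      using young_down[OF assms, of r c r c'] young_pos[OF assms, of r c] by simp
  qed
  then show ?thesis by (metis (no_types, lifting) atLeastAtMost_iff mem_Collect_eq)
qed

lemma young_row: "young (dom T) \<Longrightarrow> (r, c) \<in> dom T \<longleftrightarrow> 1 \<le> c \<and> c \<le> row_length T r"
  unfolding row_length_def by (rule young_row_card)

lemma young_remove:
  assumes "young D" "(r, Suc c) \<notin> D" "(Suc r, c) \<notin> D"
  shows "young (D - {(r, c)})"
  unfolding young_def
proof (intro conjI allI impI)
  show "finite (D - {(r, c)})" using assms by (simp add: young_finite)
  show "\<forall>(r', c')\<in>D - {(r, c)}. 1 \<le> r' \<and> 1 \<le> c'" using assms young_pos by blast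
  fix a b a' b'
  assume h: "(a, b) \<in> D - {(r, c)}" "1 \<le> a'" "a' \<le> a" "1 \<le> b'" "b' \<le> b"
  have "(a', b') \<noteq> (r, c)"
  proof
    assume "(a', b') = (r, c)"
    with h have "Suc r \<le> a \<or> Suc c \<le> b" by auto
    with assms h \<open>(a', b') = (r, c)\<close> young_down[OF \<open>young D\<close>, of a b "Suc r" c]
      young_down[OF \<open>young D\<close>, of a b r "Suc c"] show False by auto
  qed
  with h assms young_down show "(a', b') \<in> D - {(r, c)}" by blast
qed

lemma young_insert:
  assumes "young D" "1 \<le> r" "1 \<le> c" "r = 1 \<or> (r - 1, c) \<in> D" "c = 1 \<or> (r, c - 1) \<in> D"
  shows "young (insert (r, c) D)"
  unfolding young_def
proof (intro conjI allI impI)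
  show "finite (insert (r, c) D)" using assms by (simp add: young_finite)
  show "\<forall>(r', c')\<in>insert (r, c) D. 1 \<le> r' \<and> 1 \<le> c'" using assms young_pos by blast
  fix a b a' b'
  assume h: "(a, b) \<in> insert (r, c) D" "1 \<le> a'" "a' \<le> a" "1 \<le> b'" "b' \<le> b"
  show "(a', b') \<in> insert (r, c) D"
  proof (cases "(a, b) = (r, c) \<and> (a', b') \<noteq> (r, c)")
    case True
    with h have "a' \<le> r - 1 \<or> b' \<le> c - 1" "a' \<le> r" "b' \<le> c" by auto
    with assms h young_down[OF \<open>young D\<close>, of "r - 1" c a' b'] young_down[OF \<open>young D\<close>, of r "c - 1" a' b']
    show ?thesis by auto
  next
    case False
    with h assms young_down show ?thesis by blast
  qed
qed

text \<open>The relations link all pairs of boxes in a line, not only neighbours, so they survive an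
  empty box in between.\<close>

definition filled :: "('a \<Rightarrow> 'a \<Rightarrow> bool) \<Rightarrow> ('a \<Rightarrow> 'a \<Rightarrow> bool) \<Rightarrow> 'a filling \<Rightarrow> bool" where
  "filled R C T \<longleftrightarrow> along_rows R T (dom T) \<and> down_columns C T (dom T)"

lemma filled_iff:
  "filled R C T \<longleftrightarrow>
     (\<forall>r c c' a b. T (r, c) = Some a \<longrightarrow> T (r, c') = Some b \<longrightarrow> c < c' \<longrightarrow> R a b) \<and>
     (\<forall>r r' c a b. T (r, c) = Some a \<longrightarrow> T (r', c) = Some b \<longrightarrow> r < r' \<longrightarrow> C a b)"
    (is "_ \<longleftrightarrow> ?rows \<and> ?columns")
proof -
  have "along_rows R T (dom T) \<longleftrightarrow> ?rows"
    unfolding along_rows_def domIff by (metis option.collapse option.distinct(1) option.sel)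
  moreover have "down_columns C T (dom T) \<longleftrightarrow> ?columns"
    unfolding down_columns_def domIff by (metis option.collapse option.distinct(1) option.sel)
  ultimately show ?thesis unfolding filled_def by blast
qed

lemma filled_row: "filled R C T \<Longrightarrow> T (r, c) = Some a \<Longrightarrow> T (r, c') = Some b \<Longrightarrow> c < c' \<Longrightarrow> R a b"
  unfolding filled_iff by blast

lemma filled_col: "filled R C T \<Longrightarrow> T (r, c) = Some a \<Longrightarrow> T (r', c) = Some b \<Longrightarrow> r < r' \<Longrightarrow> C a b"
  unfolding filled_iff by blast

lemma filled_remove: "filled R C T \<Longrightarrow> filled R C (T(b := None))"
  unfolding filled_iff by (simp split: if_splits)

lemma filled_update:
  assumes "filled R C T"
    and "\<And>c' a. T (r, c') = Some a \<Longrightarrow> c' < c \<Longrightarrow> R a z"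
    and "\<And>c' a. T (r, c') = Some a \<Longrightarrow> c < c' \<Longrightarrow> R z a"
    and "\<And>r' a. T (r', c) = Some a \<Longrightarrow> r' < r \<Longrightarrow> C a z"
    and "\<And>r' a. T (r', c) = Some a \<Longrightarrow> r < r' \<Longrightarrow> C z a"
  shows "filled R C (T((r, c) \<mapsto> z))"
  unfolding filled_iff
proof (intro conjI allI impI)
  fix p d d' a b
  assume "(T((r, c) \<mapsto> z)) (p, d) = Some a" "(T((r, c) \<mapsto> z)) (p, d') = Some b" "d < d'"
  then show "R a b" using assms filled_row[OF assms(1)] by (auto split: if_splits)
next
  fix p p' d a b
  assume "(T((r, c) \<mapsto> z)) (p, d) = Some a" "(T((r, c) \<mapsto> z)) (p', d) = Some b" "p < p'"
  then show "C a b" using assms filled_col[OF assms(1)] by (auto split: if_splits)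
qed

text \<open>The bound \<open>Plain r \<le> a\<close> is imposed on circled letters as well, where it
  holds because every \<open>Circ\<close> exceeds every \<open>Plain\<close>.\<close>

definition spo_entries :: "letter set \<Rightarrow> letter filling \<Rightarrow> bool" where
  "spo_entries A T \<longleftrightarrow> filled row_ok col_ok T \<and> (\<forall>r c a. T (r, c) = Some a \<longrightarrow> a \<in> A \<and> Plain r \<le> a)"

definition spo_filling :: "letter set \<Rightarrow> letter filling \<Rightarrow> bool" where
  "spo_filling A T \<longleftrightarrow> young (dom T) \<and> spo_entries A T"

section \<open>Forward slides\<close>

text \<open>A filling of \<open>D\<close> with the empty box \<open>(r, c)\<close>; the order conditions also relate letters on
  different sides of the empty box.\<close>

definition punctured :: "letter set \<Rightarrow> box set \<Rightarrow> letter filling \<Rightarrow> nat \<Rightarrow> nat \<Rightarrow> bool" where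
  "punctured A D T r c \<longleftrightarrow>
     young D \<and> (r, c) \<in> D \<and> dom T = D - {(r, c)} \<and> spo_entries A T"

lemma punctured_young: "punctured A D T r c \<Longrightarrow> young D"
  by (simp add: punctured_def)

lemma Plain_mono: "r \<le> s \<Longrightarrow> Plain r \<le> Plain s"
  by (auto simp: less_eq_letter_def less_letter_def)

lemma punctured_left:
  assumes h: "punctured A D T r c" and x: "T (r, Suc c) = Some x"
    and y: "\<And>y. T (Suc r, c) = Some y \<Longrightarrow> col_ok x y"
  shows "punctured A D (T((r, c) \<mapsto> x, (r, Suc c) := None)) r (Suc c)"
proof -
  have Y: "young D" and D: "D = insert (r, c) (dom T)" and n: "T (r, c) = None"
    and F: "filled row_ok col_ok T"
    and E: "\<And>r c a. T (r, c) = Some a \<Longrightarrow> a \<in> A \<and> Plain r \<le> a"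
    using h unfolding punctured_def spo_entries_def by blast+
  define T1 where "T1 = T((r, Suc c) := None)"
  have F1: "filled row_ok col_ok T1" unfolding T1_def by (rule filled_remove[OF F])
  have T1: "T1 b = Some a \<Longrightarrow> T b = Some a" for a b by (auto simp: T1_def split: if_splits)
  have "filled row_ok col_ok (T1((r, c) \<mapsto> x))"
  proof (rule filled_update[OF F1])
    fix c' a assume "T1 (r, c') = Some a" "c' < c"
    then show "row_ok a x" using filled_row[OF F T1 x] by simp
  next
    fix c' a assume a: "T1 (r, c') = Some a" "c < c'"
    then have "c' \<noteq> Suc c" by (auto simp: T1_def)
    with a show "row_ok x a" using filled_row[OF F x T1] by simp
  next
    fix r' a assume a: "T1 (r', c) = Some a" "r' < r"
    have "(r', c) \<in> D" "(r, Suc c) \<in> D" using T1[OF a(1)] x D by auto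
    then have "(r', Suc c) \<in> D" using young_down[OF Y, of r "Suc c" r' "Suc c"] young_pos[OF Y, of r' c] a by auto
    then obtain w where w: "T (r', Suc c) = Some w" using D by auto
    \<comment> \<open>The corner is the box right of \<open>a\<close>: \<open>a\<close> precedes
      \<open>w\<close> in its row, and \<open>w\<close> stands above \<open>x\<close> in column
      \<open>Suc c\<close>.\<close>
    have "a < x" using row_col_less[OF filled_row[OF F T1[OF a(1)] w] filled_col[OF F w x]] a by simp
    then show "col_ok a x" by (rule less_col_ok)
  next
    fix r' a assume a: "T1 (r', c) = Some a" "r < r'"
    have "(r', c) \<in> D" using T1[OF a(1)] D by auto
    then have "(Suc r, c) \<in> D" using young_down[OF Y, of r' c "Suc r" c] young_pos[OF Y, of r' c] a by auto
    then obtain w where w: "T (Suc r, c) = Some w" using D by auto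
    show "col_ok x a"
    proof (cases "r' = Suc r")
      case True
      with a y T1 show ?thesis by auto
    next
      case False
      then show ?thesis using col_ok_trans[OF y[OF w] filled_col[OF F w T1[OF a(1)]]] a by auto
    qed
  qed
  moreover have "T((r, c) \<mapsto> x, (r, Suc c) := None) = T1((r, c) \<mapsto> x)"
    by (auto simp: T1_def)
  ultimately have F2: "filled row_ok col_ok (T((r, c) \<mapsto> x, (r, Suc c) := None))" by simp
  show ?thesis
    unfolding punctured_def spo_entries_def
  proof (intro conjI allI impI)
    show "(r, Suc c) \<in> D" using D x by auto
    show "dom (T((r, c) \<mapsto> x, (r, Suc c) := None)) = D - {(r, Suc c)}" using D by auto
  next
    fix p d a assume "(T((r, c) \<mapsto> x, (r, Suc c) := None)) (p, d) = Some a"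
    then show "a \<in> A" "Plain p \<le> a" using E[of p d a] E[OF x] by (auto split: if_splits)
  qed (use Y F2 in auto)
qed

text \<open>The row bound survives because a letter admissible in row \<open>Suc r\<close> is
  admissible in row \<open>r\<close>. Letters to the left are compared through their lower
  neighbours in row \<open>Suc r\<close>.\<close>

lemma punctured_up:
  assumes h: "punctured A D T r c" and x: "T (Suc r, c) = Some x"
    and y: "\<And>y. T (r, Suc c) = Some y \<Longrightarrow> row_ok x y"
  shows "punctured A D (T((r, c) \<mapsto> x, (Suc r, c) := None)) (Suc r) c"
proof -
  have Y: "young D" and D: "D = insert (r, c) (dom T)" and n: "T (r, c) = None"
    and F: "filled row_ok col_ok T"
    and E: "\<And>r c a. T (r, c) = Some a \<Longrightarrow> a \<in> A \<and> Plain r \<le> a"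
    using h unfolding punctured_def spo_entries_def by blast+
  define T1 where "T1 = T((Suc r, c) := None)"
  have F1: "filled row_ok col_ok T1" unfolding T1_def by (rule filled_remove[OF F])
  have T1: "T1 b = Some a \<Longrightarrow> T b = Some a" for a b by (auto simp: T1_def split: if_splits)
  have "filled row_ok col_ok (T1((r, c) \<mapsto> x))"
  proof (rule filled_update[OF F1])
    fix r' a assume "T1 (r', c) = Some a" "r' < r"
    then show "col_ok a x" using filled_col[OF F T1 x] by simp
  next
    fix r' a assume a: "T1 (r', c) = Some a" "r < r'"
    then have "r' \<noteq> Suc r" by (auto simp: T1_def)
    with a show "col_ok x a" using filled_col[OF F x T1] by simp
  next
    fix c' a assume a: "T1 (r, c') = Some a" "c' < c"
    have "(r, c') \<in> D" "(Suc r, c) \<in> D" using T1[OF a(1)] x D by auto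
    then have "(Suc r, c') \<in> D" using young_down[OF Y, of "Suc r" c "Suc r" c'] young_pos[OF Y, of r c'] a by auto
    then obtain w where w: "T (Suc r, c') = Some w" using D by auto
    have "a < x" using col_row_less[OF filled_col[OF F T1[OF a(1)] w] filled_row[OF F w x]] a by simp
    then show "row_ok a x" by (rule less_row_ok)
  next
    fix c' a assume a: "T1 (r, c') = Some a" "c < c'"
    have "(r, c') \<in> D" using T1[OF a(1)] D by auto
    then have "(r, Suc c) \<in> D" using young_down[OF Y, of r c' r "Suc c"] young_pos[OF Y, of r c'] a by auto
    then obtain w where w: "T (r, Suc c) = Some w" using D by auto
    show "row_ok x a"
    proof (cases "c' = Suc c")
      case True
      with a y T1 show ?thesis by auto
    next
      case False
      then show ?thesis using row_ok_trans[OF y[OF w] filled_row[OF F w T1[OF a(1)]]] a by auto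
    qed
  qed
  moreover have "T((r, c) \<mapsto> x, (Suc r, c) := None) = T1((r, c) \<mapsto> x)"
    by (auto simp: T1_def)
  ultimately have F2: "filled row_ok col_ok (T((r, c) \<mapsto> x, (Suc r, c) := None))" by simp
  show ?thesis
    unfolding punctured_def spo_entries_def
  proof (intro conjI allI impI)
    show "(Suc r, c) \<in> D" using D x by auto
    show "dom (T((r, c) \<mapsto> x, (Suc r, c) := None)) = D - {(Suc r, c)}" using D by auto
  next
    fix p d a assume "(T((r, c) \<mapsto> x, (Suc r, c) := None)) (p, d) = Some a"
    then show "a \<in> A" "Plain p \<le> a" using E[of p d a] E[OF x] Plain_mono[of r "Suc r"] by (auto split: if_splits)
  qed (use Y F2 in auto)
qed

text \<open>The slide is a chain of the two moves above, and it stops when the hole is a corner of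
  \<open>D\<close>. Rows above \<open>r\<close> stay fixed because the hole only moves right and
  down.\<close>

lemma forward_slide_punctured:
  assumes "punctured A D T r c"
  shows "\<exists>b. b \<in> D \<and> dom (forward_slide T r c) = D - {b} \<and>
    spo_filling A (forward_slide T r c) \<and> (\<forall>r'<r. \<forall>c'. forward_slide T r c (r', c') = T (r', c'))"
proof -
  have "finite D" using young_finite punctured_young[OF assms] by blast
  then have "finite ((\<lambda>(a, b). a + b) ` D)" by simp
  then obtain N where N: "\<forall>v\<in>(\<lambda>(a, b). a + b) ` D. v \<le> N"
    unfolding finite_nat_set_iff_bounded_le by blast
  \<comment> \<open>\<open>N\<close> bounds the remaining moves: each move raises the coordinate sum
    of the hole by one, and that sum is bounded on the finite set \<open>D\<close>. At
    \<open>N = 0\<close> both neighbours lie outside \<open>D\<close>.\<close>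
  have "\<forall>(a, b)\<in>D. a + b \<le> N + (r + c)"
  proof (clarify)
    fix a b assume "(a, b) \<in> D"
    with N have "a + b \<le> N" by blast
    then show "a + b \<le> N + (r + c)" by simp
  qed
  then show ?thesis using assms
  proof (induction N arbitrary: T r c)
    case 0
    then have "(r, Suc c) \<notin> D" "(Suc r, c) \<notin> D" by auto
    moreover from this have "forward_slide T r c = T"
      using 0 by (subst forward_slide.simps) (auto simp: punctured_def split: option.splits)
    moreover have "dom T = D - {(r, c)}" using 0 by (auto simp: punctured_def)
    ultimately show ?case
      using 0 young_remove[of D r c] by (intro exI[of _ "(r, c)"]) (auto simp: punctured_def spo_filling_def)
  next
    case (Suc N)
    have left: ?case if x: "T (r, Suc c) = Some x" and y: "\<And>y. T (Suc r, c) = Some y \<Longrightarrow> col_ok x y" for x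
    proof -
      have eq: "forward_slide T r c = forward_slide (T((r, c) \<mapsto> x, (r, Suc c) := None)) r (Suc c)"
        using x y by (subst forward_slide.simps) (auto simp: col_ok_def split: option.splits)
      have "\<forall>(a, b)\<in>D. a + b \<le> N + (r + c + 1)" using Suc.prems(1) by simp
      then obtain b where "b \<in> D" "dom (forward_slide T r c) = D - {b}"
        "spo_filling A (forward_slide T r c)"
        and above: "\<forall>r'<r. \<forall>c'. forward_slide T r c (r', c') = (T((r, c) \<mapsto> x, (r, Suc c) := None)) (r', c')"
        using Suc.IH[OF _ punctured_left[OF Suc.prems(2) x y]] unfolding eq[symmetric] by auto
      moreover from above have "\<forall>r'<r. \<forall>c'. forward_slide T r c (r', c') = T (r', c')" by simp
      ultimately show ?thesis by blast
    qed
    have up: ?case if x: "T (Suc r, c) = Some x" and y: "\<And>y. T (r, Suc c) = Some y \<Longrightarrow> row_ok x y" for x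
    proof -
      have eq: "forward_slide T r c = forward_slide (T((r, c) \<mapsto> x, (Suc r, c) := None)) (Suc r) c"
        using x y by (subst forward_slide.simps) (auto simp: row_ok_def split: option.splits)
      have "\<forall>(a, b)\<in>D. a + b \<le> N + (r + c + 1)" using Suc.prems(1) by simp
      then obtain b where "b \<in> D" "dom (forward_slide T r c) = D - {b}"
        "spo_filling A (forward_slide T r c)"
        and above: "\<forall>r'<Suc r. \<forall>c'. forward_slide T r c (r', c') = (T((r, c) \<mapsto> x, (Suc r, c) := None)) (r', c')"
        using Suc.IH[OF _ punctured_up[OF Suc.prems(2) x y]] unfolding eq[symmetric] by auto
      moreover from above have "\<forall>r'<r. \<forall>c'. forward_slide T r c (r', c') = T (r', c')" by simp
      ultimately show ?thesis by blast
    qed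
    show ?case
    proof (cases "T (r, Suc c)")
      case None
      show ?thesis
      proof (cases "T (Suc r, c)")
        case N2: None
        have "forward_slide T r c = T"
          using None N2 by (subst forward_slide.simps) auto
        moreover have dom: "dom T = D - {(r, c)}" using Suc.prems by (simp add: punctured_def)
        moreover have "(r, Suc c) \<notin> dom T" "(Suc r, c) \<notin> dom T" using None N2 by auto
        then have "(r, Suc c) \<notin> D" "(Suc r, c) \<notin> D" by (auto simp: dom)
        ultimately show ?thesis
          using Suc.prems young_remove[of D r c] by (intro exI[of _ "(r, c)"]) (auto simp: punctured_def spo_filling_def)
      next
        case (Some x)
        show ?thesis by (rule up[OF Some]) (simp add: None)
      qed
    next
      case (Some x)
      note x = this
      show ?thesis
      \<comment> \<open>This is the tie-break of the slide: moving \<open>y\<close> up requires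
        \<open>row_ok y x\<close>, and the complementary case gives the \<open>col_ok x y\<close>
        required for moving \<open>x\<close> left.\<close>
      proof (cases "\<exists>y. T (Suc r, c) = Some y \<and> row_ok y x")
        case True
        then obtain y where "T (Suc r, c) = Some y" "row_ok y x" by blast
        then show ?thesis using x by (intro up[of y]) simp_all
      next
        case False
        then show ?thesis by (intro left[OF x]) (simp add: not_row_ok[symmetric])
      qed
    qed
  qed
qed

section \<open>Insertion\<close>

text \<open>In \<open>insertion_ends T r z res\<close>, \<open>res\<close> is \<open>None\<close> for a cancellation and \<open>Some k\<close> if a box is
  appended to row \<open>k\<close>.\<close>

inductive insertion_ends :: "letter filling \<Rightarrow> nat \<Rightarrow> letter \<Rightarrow> nat option \<Rightarrow> bool" where
  append: "appendable z (row T r) \<Longrightarrow> insertion_ends T r z (Some r)"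
| cancel: "\<not> appendable (Plain r) (row T r) \<Longrightarrow> T (r, bump_column T r (Plain r)) = Some (Bar r) \<Longrightarrow>
    insertion_ends T r (Plain r) None"
| bump: "\<not> appendable z (row T r) \<Longrightarrow> T (r, bump_column T r z) = Some z' \<Longrightarrow>
    \<not> (z = Plain r \<and> z' = Bar r) \<Longrightarrow>
    insertion_ends (T((r, bump_column T r z) \<mapsto> z)) (Suc r) z' res \<Longrightarrow> insertion_ends T r z res"

lemma insert_append:
  "appendable z (row T r) \<Longrightarrow> insert_into_row T r z = T((r, row_length T r + 1) \<mapsto> z)"
  by (subst insert_into_row.simps) simp

lemma insert_cancel:
  "\<not> appendable (Plain r) (row T r) \<Longrightarrow> c = bump_column T r (Plain r) \<Longrightarrow> T (r, c) = Some (Bar r) \<Longrightarrow>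
   insert_into_row T r (Plain r) = forward_slide (T((r, c) := None)) r c"
  by (subst insert_into_row.simps) (simp add: Let_def)

lemma insert_bump:
  "\<not> appendable z (row T r) \<Longrightarrow> c = bump_column T r z \<Longrightarrow> T (r, c) = Some z' \<Longrightarrow>
   \<not> (z = Plain r \<and> z' = Bar r) \<Longrightarrow>
   insert_into_row T r z = insert_into_row (T((r, c) \<mapsto> z)) (Suc r) z'"
  by (subst insert_into_row.simps) (auto simp: Let_def)

lemma insertion_ends_exists:
  assumes "finite (dom T)"
  shows "\<exists>res. insertion_ends T r z res"
proof -
  have "finite (fst ` dom T)" using assms by simp
  then obtain N where N: "\<forall>v\<in>fst ` dom T. v \<le> N"
    unfolding finite_nat_set_iff_bounded_le by blast
  \<comment> \<open>All boxes lie in rows before \<open>k + r\<close>, and bumping keeps the domain,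
    so \<open>k\<close> falls as \<open>r\<close> rises. At \<open>k = 0\<close> row
    \<open>r\<close> is empty and accepts any letter.\<close>
  define k where "k = Suc N"
  have "\<forall>p\<in>dom T. fst p < k + r"
  proof
    fix p assume "p \<in> dom T"
    then have "fst p \<le> N" using N by blast
    then show "fst p < k + r" by (simp add: k_def)
  qed
  then show ?thesis
  proof (induction k arbitrary: T r z)
    case 0
    then have "row T r = {}" by (force simp: row_def)
    then have "appendable z (row T r)" by (simp add: appendable_iff)
    then show ?case using append by blast
  next
    case (Suc k)
    show ?case
    proof (cases "appendable z (row T r)")
      case True
      then show ?thesis using append by blast
    next
      case False
      then obtain z' where z': "T (r, bump_column T r z) = Some z'" by (rule bump_columnE)
      have dom': "dom (T((r, bump_column T r z) \<mapsto> z)) = dom T" using z' by auto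
      have "\<forall>p\<in>dom (T((r, bump_column T r z) \<mapsto> z)). fst p < k + Suc r"
        unfolding dom' using Suc.prems by simp
      then have "\<exists>res. insertion_ends (T((r, bump_column T r z) \<mapsto> z)) (Suc r) z' res"
        by (rule Suc.IH)
      then show ?thesis using False z' insertion_ends.intros by blast
    qed
  qed
qed

text \<open>For \<open>r > 1\<close>, \<open>(r - 1, c)\<close> is the box from which \<open>z\<close> was bumped and \<open>w\<close> the letter that
  replaced it; this makes the bumping path move weakly to the left.\<close>

definition ready :: "letter set \<Rightarrow> letter filling \<Rightarrow> nat \<Rightarrow> letter \<Rightarrow> bool" where
  "ready A T r z \<longleftrightarrow> spo_filling A T \<and> 1 \<le> r \<and> z \<in> A \<and> Plain r \<le> z \<and>
     (r = 1 \<or> (\<exists>c w. T (r - 1, c) = Some w \<and> col_ok w z \<and> (\<forall>y. T (r, c) = Some y \<longrightarrow> col_ok z y)))"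

lemma ready_place:
  assumes rdy: "ready A T r z" and c: "1 \<le> c" "c \<le> Suc (row_length T r)"
    and left: "\<And>c' y. T (r, c') = Some y \<Longrightarrow> c' < c \<Longrightarrow> row_ok y z"
    and here: "\<And>y. T (r, c) = Some y \<Longrightarrow> col_ok z y"
  shows "spo_filling A (T((r, c) \<mapsto> z))"
proof -
  have Y: "young (dom T)" and F: "filled row_ok col_ok T" and "1 \<le> r" "z \<in> A" "Plain r \<le> z"
    and E: "\<And>r c a. T (r, c) = Some a \<Longrightarrow> a \<in> A \<and> Plain r \<le> a"
    using rdy unfolding ready_def spo_filling_def spo_entries_def by blast+
  have above: "r = 1 \<or> (\<exists>a. T (r - 1, c) = Some a \<and> col_ok a z)"
  proof (cases "r = 1")
    case False
    then obtain c0 w where w: "T (r - 1, c0) = Some w" "col_ok w z"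
      and c0: "\<forall>y. T (r, c0) = Some y \<longrightarrow> col_ok z y"
      using rdy unfolding ready_def by blast
    have "1 \<le> r - 1 \<and> 1 \<le> c0" using young_pos[OF Y, of "r - 1" c0] w by auto
    \<comment> \<open>If \<open>c0\<close> were left of \<open>c\<close>, the letter
      \<open>y\<close> at \<open>(r, c0)\<close> would satisfy \<open>row_ok y z\<close>, against
      the \<open>col_ok z y\<close> supplied by \<open>ready\<close>.\<close>
    have "c \<le> c0"
    proof (rule ccontr)
      assume "\<not> c \<le> c0"
      then have "(r, c0) \<in> dom T" using c young_row[OF Y, of r c0] \<open>1 \<le> r - 1 \<and> 1 \<le> c0\<close> by simp
      then obtain y where "T (r, c0) = Some y" by blast
      then show False using c0 left[of c0 y] \<open>\<not> c \<le> c0\<close> not_row_ok by auto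
    qed
    then have "(r - 1, c) \<in> dom T"
      using young_down[OF Y, of "r - 1" c0 "r - 1" c] w c \<open>1 \<le> r - 1 \<and> 1 \<le> c0\<close> by auto
    then obtain a where a: "T (r - 1, c) = Some a" by blast
    have "col_ok a z"
    proof (cases "c = c0")
      case True
      then show ?thesis using a w by simp
    next
      case False
      then have "row_ok a w" using filled_row[OF F a w(1)] \<open>c \<le> c0\<close> by simp
      then show ?thesis using w(2) by (blast intro: less_col_ok row_col_less)
    qed
    with a show ?thesis by blast
  qed simp
  \<comment> \<open>A box weakly right of and below \<open>(r, c)\<close> forces
    \<open>(r, c)\<close> to be occupied, so the letter being replaced there mediates the comparison
    with \<open>z\<close>.\<close>
  have here_dom: "\<exists>y. T (r, c) = Some y" if "(p, d) \<in> dom T" "r \<le> p" "c \<le> d" for p d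
    using young_down[OF Y that(1) \<open>1 \<le> r\<close> that(2) c(1) that(3)] by auto
  have "filled row_ok col_ok (T((r, c) \<mapsto> z))"
  proof (rule filled_update[OF F])
    fix c' a assume a: "T (r, c') = Some a" "c < c'"
    then obtain y where "T (r, c) = Some y" using here_dom[of r c'] by auto
    then show "row_ok z a"
      using col_row_less[OF here filled_row[OF F _ a(1)]] a(2) less_row_ok by blast
  next
    fix p a assume a: "T (p, c) = Some a" "p < r"
    then have "1 \<le> p" using young_pos[OF Y, of p c] by auto
    with a above obtain b where b: "T (r - 1, c) = Some b" "col_ok b z" by auto
    show "col_ok a z"
    proof (cases "p = r - 1")
      case True
      with a b show ?thesis by simp
    next
      case False
      then have "p < r - 1" using a(2) by simp
      then show ?thesis using filled_col[OF F a(1) b(1)] b(2) by (blast intro: col_ok_trans)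
    qed
  next
    fix p a assume a: "T (p, c) = Some a" "r < p"
    then obtain y where "T (r, c) = Some y" using here_dom[of p c] by auto
    then show "col_ok z a"
      using col_ok_trans[OF here filled_col[OF F _ a(1)]] a(2) by blast
  qed (rule left)
  moreover have "young (insert (r, c) (dom T))"
  proof (rule young_insert[OF Y])
    show "r = 1 \<or> (r - 1, c) \<in> dom T" using above by auto
    show "c = 1 \<or> (r, c - 1) \<in> dom T" using young_row[OF Y, of r "c - 1"] c by auto
  qed (use c \<open>1 \<le> r\<close> in auto)
  ultimately show ?thesis
    unfolding spo_filling_def spo_entries_def
    using E \<open>z \<in> A\<close> \<open>Plain r \<le> z\<close> by (auto split: if_splits)
qed

text \<open>\<open>col_ok\<close> is strict on uncircled letters, so an uncircled \<open>z'\<close>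
  is at least \<open>Bar r\<close>; if it equals \<open>Bar r\<close>, only \<open>Plain r\<close>
  is left for \<open>z\<close>, which is the excluded cancellation.\<close>

lemma bumped_ge:
  assumes "Plain r \<le> z" "col_ok z z'" "\<not> (z = Plain r \<and> z' = Bar r)"
  shows "Plain (Suc r) \<le> z'"
  using assms by (cases z; cases z') (auto simp: less_letter_def less_eq_letter_def col_ok_def)

lemma ready_bump:
  assumes rdy: "ready A T r z" and na: "\<not> appendable z (row T r)"
    and z': "T (r, bump_column T r z) = Some z'" and nc: "\<not> (z = Plain r \<and> z' = Bar r)"
  shows "ready A (T((r, bump_column T r z) \<mapsto> z)) (Suc r) z'"
proof -
  let ?c = "bump_column T r z"
  let ?T = "T((r, ?c) \<mapsto> z)"
  have zz': "col_ok z z'" using bump_columnE[OF na] z' by auto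
  have Y: "young (dom T)" and z: "Plain r \<le> z" and F: "filled row_ok col_ok T" and "z' \<in> A"
    using rdy z' by (auto simp: ready_def spo_filling_def spo_entries_def)
  have "spo_filling A ?T"
  proof (rule ready_place[OF rdy])
    show "1 \<le> ?c" "?c \<le> Suc (row_length T r)" using young_row[OF Y, of r ?c] z' by auto
    show "row_ok y z" if "T (r, c') = Some y" "c' < ?c" for c' y
      using bump_column_left that by blast
    show "col_ok z y" if "T (r, ?c) = Some y" for y using that z' zz' by simp
  qed
  moreover have "?T (Suc r - 1, ?c) = Some z" by simp
  \<comment> \<open>The letter below \<open>z'\<close> was ordered against it before
    \<open>z'\<close> left its column; this is the condition that \<open>ready\<close> asks for in
    the next row.\<close>
  moreover have "col_ok z' y" if "?T (Suc r, ?c) = Some y" for y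
    using that filled_col[OF F z'] by simp
  ultimately show ?thesis
    unfolding ready_def using zz' \<open>z' \<in> A\<close> bumped_ge[OF z zz' nc]
    by (metis One_nat_def le_add1 plus_1_eq_Suc)
qed

text \<open>The clause on rows above \<open>r\<close> means that a row is final once its letter has
  been placed; the comparison with a second insertion relies on this.\<close>

lemma insertion_result:
  assumes "insertion_ends T r z res" "ready A T r z"
  defines "T' \<equiv> insert_into_row T r z"
  shows "spo_filling A T' \<and> (\<forall>r'<r. \<forall>c. T' (r', c) = T (r', c)) \<and>
    (case res of None \<Rightarrow> \<exists>b\<in>dom T. dom T' = dom T - {b}
     | Some k \<Rightarrow> \<exists>c. (k, c) \<notin> dom T \<and> dom T' = insert (k, c) (dom T))"
  using assms(1,2) unfolding T'_def
proof (induction rule: insertion_ends.induct)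
  case (append z T r)
  let ?c = "row_length T r + 1"
  have Y: "young (dom T)" using append by (simp add: ready_def spo_filling_def)
  have n: "(r, ?c) \<notin> dom T" using young_row[OF Y, of r ?c] by simp
  have "spo_filling A (T((r, ?c) \<mapsto> z))"
  proof (rule ready_place[OF append.prems])
    show "row_ok y z" if "T (r, c') = Some y" for c' y
      using append.hyps that by (auto simp: appendable_iff row_def)
  qed (use n in auto)
  moreover have "dom (T((r, ?c) \<mapsto> z)) = insert (r, ?c) (dom T)" by simp
  moreover have "\<forall>r'<r. \<forall>c. (T((r, ?c) \<mapsto> z)) (r', c) = T (r', c)" by simp
  ultimately show ?case using n unfolding insert_append[OF append.hyps] option.case by blast
next
  case (cancel r T)
  define c where "c = bump_column T r (Plain r)"
  have "punctured A (dom T) (T((r, c) := None)) r c"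
    using cancel.hyps cancel.prems filled_remove[of row_ok col_ok T "(r, c)"]
    unfolding punctured_def ready_def spo_filling_def spo_entries_def c_def[symmetric]
    by (auto split: if_splits)
  from forward_slide_punctured[OF this]
  show ?case unfolding insert_cancel[OF cancel.hyps(1) refl cancel.hyps(2)] c_def[symmetric] by auto
next
  case (bump z T r z' res)
  define c where "c = bump_column T r z"
  define T1 where "T1 = T((r, c) \<mapsto> z)"
  have z': "T (r, c) = Some z'" using bump.hyps(2) by (simp add: c_def)
  have dom1: "dom T1 = dom T" using z' by (auto simp: T1_def)
  have "ready A T1 (Suc r) z'"
    using ready_bump[OF bump.prems bump.hyps(1-3)] unfolding T1_def c_def .
  then have IH: "spo_filling A (insert_into_row T1 (Suc r) z') \<and>
     (\<forall>r'<Suc r. \<forall>c. insert_into_row T1 (Suc r) z' (r', c) = T1 (r', c)) \<and>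
     (case res of None \<Rightarrow> \<exists>b\<in>dom T1. dom (insert_into_row T1 (Suc r) z') = dom T1 - {b}
      | Some k \<Rightarrow> \<exists>c. (k, c) \<notin> dom T1 \<and> dom (insert_into_row T1 (Suc r) z') = insert (k, c) (dom T1))"
    using bump.IH unfolding T1_def c_def by blast
  have eq: "insert_into_row T r z = insert_into_row T1 (Suc r) z'"
    unfolding T1_def by (rule insert_bump[OF bump.hyps(1) c_def z' bump.hyps(3)])
  have "\<forall>r'<r. \<forall>c. T1 (r', c) = T (r', c)" by (simp add: T1_def)
  then show ?case using IH unfolding dom1 eq by simp
qed

section \<open>Two successive insertions\<close>

text \<open>The second letter bumps at or to the left of the place taken by the first one, hence a letter
  at most the first bumped one (strictly less in $B_0$), so the comparison propagates to the next row.\<close>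

lemma second_bump:
  assumes "\<not> appendable z (row T r)" "T (r, bump_column T r z) = Some z'"
    and row: "\<And>c. T2 (r, c) = (T((r, bump_column T r z) \<mapsto> z)) (r, c)"
    and z2: "col_ok z2 z"
  obtains y where "\<not> appendable z2 (row T2 r)" "T2 (r, bump_column T2 r z2) = Some y"
    "col_ok z2 y" "col_ok y z'"
proof -
  define c where "c = bump_column T r z"
  have zz': "col_ok z z'" using bump_columnE[OF assms(1)] assms(2) by auto
  have z: "T2 (r, c) = Some z" using row by (simp add: c_def)
  then have na: "\<not> appendable z2 (row T2 r)"
    using z2 by (auto simp: appendable_iff row_def not_row_ok[symmetric])
  then obtain y where y: "T2 (r, bump_column T2 r z2) = Some y" "col_ok z2 y" by (rule bump_columnE)
  have le: "bump_column T2 r z2 \<le> c" using z z2 by (rule bump_column_le)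
  have "col_ok y z'"
  proof (cases "bump_column T2 r z2 = c")
    case True
    then show ?thesis using y z zz' by simp
  next
    case False
    then have "T (r, bump_column T2 r z2) = Some y" using y row by (simp add: c_def)
    then have "row_ok y z" using False le bump_column_left unfolding c_def by simp
    then show ?thesis using zz' by (blast intro: less_col_ok row_col_less)
  qed
  with na y show ?thesis using that by blast
qed

text \<open>The premises exclude appending and cancelling, so the first step is a proper
  bump.\<close>

lemma insertion_ends_bumpD:
  assumes "insertion_ends T r z res" "\<not> appendable z (row T r)" "T (r, bump_column T r z) = Some z'"
    and "res = Some k"
  shows "\<not> (z = Plain r \<and> z' = Bar r) \<and> insertion_ends (T((r, bump_column T r z) \<mapsto> z)) (Suc r) z' res"
  using assms by (cases rule: insertion_ends.cases) auto

lemma insertion_ends_ge: "insertion_ends T r z res \<Longrightarrow> res = Some k \<Longrightarrow> r \<le> k"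
  by (induction rule: insertion_ends.induct) auto

text \<open>If the first insertion cancels in row \<open>r\<close>, the second one would have to bring a letter below
  \<open>Plain r\<close> into row \<open>r\<close>, so it has cancelled before. \<open>T2\<close> agrees with the result of the first insertion
  only from row \<open>r\<close> on, since the second insertion has already changed the rows above.\<close>

lemma second_insertion:
  assumes "insertion_ends T r z res" "ready A T r z" "col_ok z2 z" "Plain r \<le> z2"
    and "\<And>r' c. r \<le> r' \<Longrightarrow> T2 (r', c) = insert_into_row T r z (r', c)"
    and "insertion_ends T2 r z2 (Some k2)"
  shows "\<exists>k. res = Some k \<and> k < k2"
  using assms
proof (induction arbitrary: T2 z2 rule: insertion_ends.induct)
  case (append z T r)
  \<comment> \<open>The first letter \<open>z\<close> sits in row \<open>r\<close> and can be bumped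
    by \<open>z2\<close>, so \<open>z2\<close> is not appended there and its box ends up strictly
    lower.\<close>
  have "T2 (r, row_length T r + 1) = Some z"
    using append.prems(4)[of r] insert_append[OF append.hyps] by simp
  then have na: "\<not> appendable z2 (row T2 r)"
    using append.prems(2) by (auto simp: appendable_iff row_def not_row_ok[symmetric])
  then obtain y where "T2 (r, bump_column T2 r z2) = Some y" by (rule bump_columnE)
  from insertion_ends_ge[OF conjunct2[OF insertion_ends_bumpD[OF append.prems(5) na this refl]] refl]
  show ?case by simp
next
  case (cancel r T)
  have "\<not> col_ok z2 (Plain r)" using cancel.prems(3) by (auto simp: col_ok_def)
  with cancel.prems show ?case by blast
next
  case (bump z T r z' res)
  define c where "c = bump_column T r z"
  define T1 where "T1 = T((r, c) \<mapsto> z)"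
  have z': "T (r, c) = Some z'" using bump.hyps(2) by (simp add: c_def)
  have eq: "insert_into_row T r z = insert_into_row T1 (Suc r) z'"
    unfolding T1_def by (rule insert_bump[OF bump.hyps(1) c_def z' bump.hyps(3)])
  have rdy: "ready A T1 (Suc r) z'"
    using ready_bump[OF bump.prems(1) bump.hyps(1-3)] unfolding T1_def c_def .
  have "T2 (r, d) = (T((r, bump_column T r z) \<mapsto> z)) (r, d)" for d
    using bump.prems(4)[of r d] insertion_result[OF bump.hyps(4)] rdy
    unfolding eq T1_def c_def by simp
  then obtain y where y: "\<not> appendable z2 (row T2 r)" "T2 (r, bump_column T2 r z2) = Some y"
    "col_ok z2 y" "col_ok y z'"
    using second_bump[OF bump.hyps(1,2) _ bump.prems(2)] by blast
  note D = insertion_ends_bumpD[OF bump.prems(5) y(1,2) refl]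
  show ?case
  proof (rule bump.IH[OF _ y(4)])
    show "ready A (T((r, bump_column T r z) \<mapsto> z)) (Suc r) z'" using rdy unfolding T1_def c_def .
    show "Plain (Suc r) \<le> y" using bumped_ge[OF bump.prems(3) y(3)] D by blast
    show "insertion_ends (T2((r, bump_column T2 r z2) \<mapsto> z2)) (Suc r) y (Some k2)" using D by blast
    show "(T2((r, bump_column T2 r z2) \<mapsto> z2)) (r', d) =
        insert_into_row (T((r, bump_column T r z) \<mapsto> z)) (Suc r) z' (r', d)" if "Suc r \<le> r'" for r' d
      using that bump.prems(4)[of r' d] unfolding eq T1_def c_def by auto
  qed
qed

section \<open>Reverse dual row insertion\<close>

definition strict_filling :: "nat filling \<Rightarrow> bool" where
  "strict_filling P \<longleftrightarrow> young (dom P) \<and> filled (<) (\<le>) P"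

text \<open>The column in the premise is the one that \<open>x\<close> has just left: its entry in
  row \<open>r\<close> is at most \<open>x\<close>, so the maximum is taken over a nonempty set, and
  whatever now stands below is at least \<open>x\<close>. On its way up the path moves weakly to the
  right.\<close>

lemma reverse_bump_result:
  assumes "strict_filling P" "r = 0 \<or> (\<exists>c y. P (r, c) = Some y \<and> y \<le> x \<and> (\<forall>z. P (Suc r, c) = Some z \<longrightarrow> x \<le> z))"
    and "reverse_bump P r x = (P', a)"
  shows "strict_filling P' \<and> dom P' = dom P \<and> ran P' \<subseteq> insert x (ran P) \<and> a \<in> insert x (ran P)"
  using assms
proof (induction r arbitrary: P x)
  case 0
  then show ?case by auto
next
  case (Suc r)
  then obtain c0 y0 where y0: "P (Suc r, c0) = Some y0" "y0 \<le> x"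
    and below: "\<And>z. P (Suc (Suc r), c0) = Some z \<Longrightarrow> x \<le> z" by blast
  have Y: "young (dom P)" and F: "filled (<) (\<le>) P" using Suc.prems by (auto simp: strict_filling_def)
  define S where "S = {y \<in> row P (Suc r). y \<le> x}"
  have "finite S" "y0 \<in> S" using y0 by (auto simp: S_def row_def)
  define x' where "x' = Max S"
  have "x' \<in> S" using Max_in[OF \<open>finite S\<close>] \<open>y0 \<in> S\<close> by (auto simp: x'_def)
  then obtain c where c: "P (Suc r, c) = Some x'" and "x' \<le> x" by (auto simp: S_def row_def)
  have max: "y \<le> x'" if "P (Suc r, d) = Some y" "y \<le> x" for d y
    using that \<open>finite S\<close> unfolding x'_def by (intro Max_ge) (auto simp: S_def row_def)
  have the: "(THE c. P (Suc r, c) = Some x') = c"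
  proof (rule the_equality)
    show "P (Suc r, c) = Some x'" by (rule c)
    fix d assume "P (Suc r, d) = Some x'"
    then show "d = c" using filled_row[OF F _ c] filled_row[OF F c] by (metis less_irrefl nat_neq_iff)
  qed
  define P1 where "P1 = P((Suc r, c) \<mapsto> x)"
  have dom1: "dom P1 = dom P" using c by (auto simp: P1_def)
  have eq: "reverse_bump P1 r x' = (P', a)"
    using Suc.prems(3) the by (simp add: P1_def x'_def S_def Let_def)
  \<comment> \<open>\<open>y0\<close> competes for the maximum \<open>x'\<close>, so strictness of
    the row puts \<open>x'\<close> weakly right of \<open>y0\<close>.\<close>
  have "c0 \<le> c"
  proof (rule ccontr)
    assume "\<not> c0 \<le> c"
    then have "x' < y0" using filled_row[OF F c y0(1)] by simp
    then show False using max[OF y0] by simp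
  qed
  have "filled (<) (\<le>) P1" unfolding P1_def
  proof (rule filled_update[OF F])
    fix d b assume "P (Suc r, d) = Some b" "d < c"
    then show "b < x" using filled_row[OF F _ c] \<open>x' \<le> x\<close> by fastforce
  next
    fix d b assume "P (Suc r, d) = Some b" "c < d"
    then show "x < b" using filled_row[OF F c] max by (metis not_le)
  next
    fix p b assume "P (p, c) = Some b" "p < Suc r"
    then show "b \<le> x" using filled_col[OF F _ c] \<open>x' \<le> x\<close> by fastforce
  next
    \<comment> \<open>The chain is \<open>x \<le> v \<le> u \<le> b\<close>: \<open>v\<close> stands
      in column \<open>c0\<close>, where the premise applies, and \<open>u\<close> in the same row
      in column \<open>c\<close>.\<close>
    fix p b assume b: "P (p, c) = Some b" "Suc r < p"
    have pos: "1 \<le> p" "1 \<le> c0" using young_pos[OF Y] b y0 by blast+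
    have "(Suc (Suc r), c) \<in> dom P" "(Suc (Suc r), c0) \<in> dom P"
      using young_down[OF Y, of p c "Suc (Suc r)" c] young_down[OF Y, of p c "Suc (Suc r)" c0] b pos \<open>c0 \<le> c\<close> by auto
    then obtain u v where u: "P (Suc (Suc r), c) = Some u" and v: "P (Suc (Suc r), c0) = Some v" by blast
    have "v \<le> u" using filled_row[OF F v u] \<open>c0 \<le> c\<close> u v by (cases "c0 = c") auto
    moreover have "u \<le> b" using filled_col[OF F u b(1)] b u by (cases "p = Suc (Suc r)") auto
    ultimately show "x \<le> b" using below[OF v] by simp
  qed
  then have S1: "strict_filling P1" using Y dom1 by (simp add: strict_filling_def)
  have ran1: "ran P1 \<subseteq> insert x (ran P)" by (auto simp: P1_def ran_def)
  have "x' \<in> ran P" using c by (auto simp: ran_def)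
  \<comment> \<open>The next column is \<open>c\<close>: the entry above \<open>x'\<close> is at
    most \<open>x'\<close>, and the box that \<open>x'\<close> left now holds
    \<open>x\<close>.\<close>
  have "r = 0 \<or> (\<exists>c y. P1 (r, c) = Some y \<and> y \<le> x' \<and> (\<forall>z. P1 (Suc r, c) = Some z \<longrightarrow> x' \<le> z))"
  proof (cases "r = 0")
    case False
    have "(r, c) \<in> dom P" using young_down[OF Y, of "Suc r" c r c] young_pos[OF Y, of "Suc r" c] c False by auto
    then obtain y where y: "P (r, c) = Some y" by blast
    then have "y \<le> x'" using filled_col[OF F y c] by simp
    then show ?thesis using y \<open>x' \<le> x\<close> by (intro disjI2 exI[of _ c] exI[of _ y]) (auto simp: P1_def)
  qed simp
  from Suc.IH[OF S1 this eq] show ?case using dom1 ran1 \<open>x' \<in> ran P\<close> by auto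
qed

lemma reverse_dual_row_insert_result:
  assumes "strict_filling P" "b \<in> dom P" "young (dom P - {b})" "reverse_dual_row_insert P b = (P', a)"
  shows "strict_filling P' \<and> dom P' = dom P - {b} \<and> ran P' \<subseteq> ran P \<and> a \<in> ran P"
proof -
  obtain r c where b: "b = (r, c)" by fastforce
  obtain x where x: "P b = Some x" using assms by blast
  have Y: "young (dom P)" and F: "filled (<) (\<le>) P" using assms by (auto simp: strict_filling_def)
  have "1 \<le> r" "1 \<le> c" using young_pos[OF Y] assms(2) b by auto
  define P1 where "P1 = P(b := None)"
  have dom1: "dom P1 = dom P - {b}" by (auto simp: P1_def)
  have "strict_filling P1" using assms(3) dom1 filled_remove[OF F] by (simp add: strict_filling_def P1_def)
  \<comment> \<open>The column of \<open>b\<close> serves: the box below \<open>(r - 1, c)\<close>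
    is \<open>b\<close> itself, just emptied, so the condition on it is vacuous.\<close>
  moreover have "r - 1 = 0 \<or> (\<exists>c y. P1 (r - 1, c) = Some y \<and> y \<le> x \<and> (\<forall>z. P1 (Suc (r - 1), c) = Some z \<longrightarrow> x \<le> z))"
  proof (cases "r - 1 = 0")
    case False
    have "(r - 1, c) \<in> dom P" using young_down[OF Y, of r c "r - 1" c] assms(2) b False \<open>1 \<le> c\<close> by auto
    then obtain y where y: "P (r - 1, c) = Some y" by blast
    then have "y \<le> x" using filled_col[OF F y] x b False by auto
    then show ?thesis using y b \<open>1 \<le> r\<close> by (intro disjI2 exI[of _ c] exI[of _ y]) (auto simp: P1_def)
  qed simp
  moreover have "reverse_bump P1 (r - 1) x = (P', a)"
    using assms(4) x b by (simp add: reverse_dual_row_insert_def P1_def)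
  ultimately have "strict_filling P' \<and> dom P' = dom P1 \<and> ran P' \<subseteq> insert x (ran P1) \<and> a \<in> insert x (ran P1)"
    by (rule reverse_bump_result)
  moreover have "insert x (ran P1) \<subseteq> ran P" using x b by (auto simp: P1_def ran_def split: if_splits)
  ultimately show ?thesis using dom1 by auto
qed

section \<open>Partitions\<close>

lemma young_partition:
  assumes Y: "young D"
  shows "\<exists>lam. is_partition lam \<and> diagram lam = D"
proof -
  define h where "h = card {r. (r, 1) \<in> D}"
  have "{r. (r, 1) \<in> D} = {1..h}" unfolding h_def
  proof (rule down_closed_interval)
    have "finite (fst ` D)" using Y by (simp add: young_finite)
    then show "finite {r. (r, 1) \<in> D}"
      by (rule rev_finite_subset) (force simp: image_iff)
  next
    show "0 \<notin> {r. (r, 1) \<in> D}" using young_pos[OF Y, of 0 1] by auto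
  next
    fix r r' assume "r \<in> {r. (r, 1) \<in> D}" "1 \<le> r'" "r' \<le> r"
    then show "r' \<in> {r. (r, 1) \<in> D}" using young_down[OF Y, of r 1 r' 1] by simp
  qed
  then have rows: "(r, 1) \<in> D \<longleftrightarrow> 1 \<le> r \<and> r \<le> h" for r by auto
  define len where "len r = card {c. (r, c) \<in> D}" for r
  have cols: "(r, c) \<in> D \<longleftrightarrow> 1 \<le> c \<and> c \<le> len r" for r c
    unfolding len_def by (rule young_row_card[OF Y])
  define lam where "lam = map len [1..<Suc h]"
  have nth: "lam ! k = len (Suc k)" if "k < h" for k
    using that by (simp add: lam_def del: upt_Suc)
  have length: "length lam = h" by (simp add: lam_def)
  have "len (Suc j) \<le> len (Suc i)" if "i < j" for i j
  proof (cases "len (Suc j) = 0")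
    case False
    then have "(Suc j, len (Suc j)) \<in> D" using cols by simp
    then have "(Suc i, len (Suc j)) \<in> D"
      using young_down[OF Y, of "Suc j" "len (Suc j)" "Suc i" "len (Suc j)"] that False by simp
    then show ?thesis using cols by simp
  qed simp
  then have "sorted_wrt (\<ge>) lam" by (auto simp: sorted_wrt_iff_nth_less length nth)
  moreover have "\<forall>p\<in>set lam. 0 < p"
  proof
    fix p assume "p \<in> set lam"
    then obtain r where "1 \<le> r" "r \<le> h" "p = len r" by (auto simp: lam_def)
    then show "0 < p" using rows[of r] cols[of r 1] by simp
  qed
  moreover have "diagram lam = D"
  proof (intro set_eqI)
    fix b :: box
    obtain r c where b: "b = (r, c)" by fastforce
    have "1 \<le> r \<and> r \<le> h" if "(r, c) \<in> D"
      using that rows[of r] young_down[OF Y that, of r 1] young_pos[OF Y that] by simp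
    then show "b \<in> diagram lam \<longleftrightarrow> b \<in> D"
      unfolding diagram_def b using cols[of r c] by (auto simp: length nth)
  qed
  ultimately show ?thesis unfolding is_partition_def by blast
qed

text \<open>In a weakly decreasing list the parts that are at least \<open>r\<close> form an initial
  segment, so their number determines their positions.\<close>

lemma less_length_filter_ge:
  fixes lam :: "nat list"
  assumes "sorted_wrt (\<ge>) lam"
  shows "k < length (filter (\<lambda>p. r \<le> p) lam) \<longleftrightarrow> k < length lam \<and> r \<le> lam ! k"
  using assms
proof (induction lam arbitrary: k)
  case (Cons a lam)
  show ?case
  proof (cases "r \<le> a")
    case True
    then show ?thesis using Cons by (cases k) auto
  next
    case False
    then have "\<forall>p\<in>set (a # lam). \<not> r \<le> p" using Cons.prems by auto
    then show ?thesis by (metis filter_False length_0_conv not_less_zero nth_mem)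
  qed
qed simp

lemma le_foldr_max_iff:
  "1 \<le> r \<Longrightarrow> r \<le> foldr max lam (0::nat) \<longleftrightarrow> (\<exists>p\<in>set lam. r \<le> p)"
  by (induction lam) auto

lemma conjugate_partition:
  assumes "is_partition lam"
  shows "is_partition (conjugate lam)" and "diagram (conjugate lam) = {(r, c). (c, r) \<in> diagram lam}"
proof -
  have S: "sorted_wrt (\<ge>) lam" using assms by (simp add: is_partition_def)
  define N where "N = foldr max lam 0"
  define f where "f r = length (filter (\<lambda>p. r \<le> p) lam)" for r
  have conj: "conjugate lam = map f [1..<Suc N]"
    by (simp add: conjugate_def N_def f_def)
  have length: "length (conjugate lam) = N" by (simp add: conj)
  have nth: "conjugate lam ! k = f (Suc k)" if "k < N" for k
    using that by (simp add: conj del: upt_Suc)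
  have f: "k < f r \<longleftrightarrow> k < length lam \<and> r \<le> lam ! k" for k r
    unfolding f_def by (rule less_length_filter_ge[OF S])
  have N: "r \<le> N \<longleftrightarrow> (\<exists>k<length lam. r \<le> lam ! k)" if "1 \<le> r" for r
    unfolding N_def le_foldr_max_iff[OF that] by (metis in_set_conv_nth)
  \<comment> \<open>If \<open>f i < f j\<close>, position \<open>f i\<close> would hold a part that
    is at least \<open>j\<close>, hence at least \<open>i\<close>, and would already be counted by
    \<open>f i\<close>.\<close>
  have "f j \<le> f i" if "i < j" for i j
    using f[of "f i" i] f[of "f i" j] that by (meson leI less_irrefl less_imp_le order_trans)
  then have "sorted_wrt (\<ge>) (conjugate lam)" by (simp add: sorted_wrt_iff_nth_less length nth)
  moreover have "0 < f r" if "1 \<le> r" "r \<le> N" for r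
  proof -
    from that N obtain k where "k < length lam" "r \<le> lam ! k" by blast
    then have "k < f r" using f by blast
    then show ?thesis by simp
  qed
  ultimately show "is_partition (conjugate lam)"
    unfolding is_partition_def by (auto simp: conj)
  have "(r, c) \<in> diagram (conjugate lam) \<longleftrightarrow> (c, r) \<in> diagram lam" for r c
  proof (cases "1 \<le> r \<and> 1 \<le> c")
    case True
    then obtain r' c' where "r = Suc r'" "c = Suc c'" by (metis Suc_le_D One_nat_def)
    then show ?thesis
      using f[of c' r] N[of r] by (auto simp: diagram_def length nth Suc_le_eq)
  qed (auto simp: diagram_def)
  then show "diagram (conjugate lam) = {(r, c). (c, r) \<in> diagram lam}" by auto
qed

text \<open>The comparison passes through the corner \<open>(r, c')\<close>. As circled letters are
  the larger ones, it makes the uncircled boxes closed towards the upper left.\<close>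

lemma spo_filling_mono:
  assumes "spo_filling A T" "T (r, c) = Some a" "T (r', c') = Some b" "r \<le> r'" "c \<le> c'"
  shows "a \<le> b"
proof -
  have Y: "young (dom T)" and F: "filled row_ok col_ok T"
    using assms(1) by (auto simp: spo_filling_def spo_entries_def)
  have "(r, c') \<in> dom T"
    using young_down[OF Y, of r' c' r c'] young_pos[OF Y, of r c] young_pos[OF Y, of r' c'] assms by auto
  then obtain d where d: "T (r, c') = Some d" by blast
  have "a \<le> d"
    using row_ok_le[OF filled_row[OF F assms(2) d]] assms(2,5) d by (cases "c = c'") auto
  also have "d \<le> b"
    using col_ok_le[OF filled_col[OF F d assms(3)]] assms(3,4) d by (cases "r = r'") auto
  finally show ?thesis .
qed

lemma B0_iff: "a \<in> B0 m \<union> B1 n \<Longrightarrow> a \<in> B0 m \<longleftrightarrow> \<not> is_Circ a"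
  by (auto simp: B0_def B1_def)

lemma is_Circ_mono: "a \<le> b \<Longrightarrow> is_Circ a \<Longrightarrow> is_Circ b"
  by (cases a; cases b) (auto simp: less_eq_letter_def less_letter_def)

text \<open>The inner shape is the set \<open>M\<close> of uncircled boxes: on it
  \<open>col_ok\<close> is strict, off it \<open>row_ok\<close> is strict.\<close>

lemma spo_filling_tableau:
  assumes T: "spo_filling (B0 m \<union> B1 n) T" and lam: "is_partition lam" "diagram lam = dom T"
  shows "spo_tableau m n lam T"
proof -
  let ?A = "B0 m \<union> B1 n"
  have Y: "young (dom T)" and F: "filled row_ok col_ok T"
    and E: "\<And>r c a. T (r, c) = Some a \<Longrightarrow> a \<in> ?A \<and> Plain r \<le> a"
    using T unfolding spo_filling_def spo_entries_def by blast+
  define M where "M = {b \<in> dom T. the (T b) \<in> B0 m}"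
  have M: "(r, c) \<in> M \<longleftrightarrow> (\<exists>a. T (r, c) = Some a \<and> \<not> is_Circ a)" for r c
    unfolding M_def using E B0_iff by fastforce
  have "young M"
    unfolding young_def
  proof (intro conjI allI impI)
    show "finite M" using young_finite[OF Y] by (simp add: M_def)
    show "\<forall>(r, c)\<in>M. 1 \<le> r \<and> 1 \<le> c" using young_pos[OF Y] by (auto simp: M_def)
    fix r c r' c'
    assume h: "(r, c) \<in> M" "1 \<le> r'" "r' \<le> r" "1 \<le> c'" "c' \<le> c"
    from h(1) obtain a where a: "T (r, c) = Some a" "\<not> is_Circ a" using M by blast
    have "(r', c') \<in> dom T" using young_down[OF Y _ h(2-5)] a by blast
    then obtain b where b: "T (r', c') = Some b" by blast
    have "b \<le> a" by (rule spo_filling_mono[OF T b a(1) h(3,5)])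
    then show "(r', c') \<in> M" using M b a is_Circ_mono by blast
  qed
  then obtain mu where mu: "is_partition mu" "diagram mu = M" using young_partition by blast
  have rows: "row_ok (the (T (r, c))) (the (T (r, c')))" if "(r, c) \<in> dom T" "(r, c') \<in> dom T" "c < c'" for r c c'
    using that filled_row[OF F] by auto
  have cols: "col_ok (the (T (r, c))) (the (T (r', c)))" if "(r, c) \<in> dom T" "(r', c) \<in> dom T" "r < r'" for r r' c
    using that filled_col[OF F] by auto
  have sub: "M \<subseteq> dom T" by (auto simp: M_def)
  have inM: "\<not> is_Circ (the (T b))" if "b \<in> M" for b using that M by (cases b) fastforce
  have notM: "is_Circ (the (T b))" if "b \<in> dom T - M" for b using that M by (cases b) fastforce
  show ?thesis
    unfolding spo_tableau_def
  proof (intro conjI exI[of _ mu])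
    show "ran T \<subseteq> ?A" using E by (fastforce simp: ran_def)
    show "along_rows (\<le>) T (diagram mu)"
      unfolding along_rows_def mu(2) using rows row_ok_le sub by blast
    show "down_columns (<) T (diagram mu)"
      unfolding down_columns_def mu(2) using cols inM sub unfolding col_ok_def by blast
    show "\<forall>(r, c)\<in>diagram mu. Plain r \<le> the (T (r, c))"
      unfolding mu(2) using M E by fastforce
    show "along_rows (<) T (diagram lam - diagram mu)"
      unfolding along_rows_def mu(2) lam(2) using rows notM unfolding row_ok_def by blast
    show "down_columns (\<le>) T (diagram lam - diagram mu)"
      unfolding down_columns_def mu(2) lam(2) using cols col_ok_le by blast
  qed (use lam mu sub in \<open>simp_all add: M_def\<close>)
qed

lemma strict_filling_transpose:
  assumes "strict_filling P" "is_partition lam" "diagram lam = dom P"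
  shows "semistandard_tableau (conjugate lam) (transpose_filling P)"
    and "ran (transpose_filling P) = ran P"
proof -
  have F: "filled (<) (\<le>) P" using assms by (simp add: strict_filling_def)
  have "dom (transpose_filling P) = {(r, c). (c, r) \<in> dom P}"
    by (auto simp: transpose_filling_def)
  moreover have "filled (\<le>) (<) (transpose_filling P)"
    using F unfolding filled_iff transpose_filling_def by simp
  ultimately show "semistandard_tableau (conjugate lam) (transpose_filling P)"
    using conjugate_partition[OF assms(2)] assms(3)
    by (simp add: semistandard_tableau_def filled_def)
  show "ran (transpose_filling P) = ran P"
    by (auto simp: ran_def transpose_filling_def)
qed

section \<open>Two-line arrays\<close>

text \<open>The neighbour condition of \<open>dual_Burge\<close> as a transitive relation, so that
  sortedness can be split along blocks.\<close>

definition burge_less :: "nat \<times> nat \<Rightarrow> nat \<times> nat \<Rightarrow> bool" where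
  "burge_less u v \<longleftrightarrow> fst u < fst v \<or> fst u = fst v \<and> snd v \<le> snd u"

lemma set_reorder_blocks: "set (reorder_blocks L) = set L"
proof (induction L rule: reorder_blocks.induct)
  case (2 p L)
  let ?P = "\<lambda>u. fst u = fst p"
  have "(fst p, snd u) = u" if "u \<in> set (takeWhile ?P (p # L))" for u
    using set_takeWhileD[OF that] by (simp add: prod_eq_iff)
  then have "(\<lambda>u. (fst p, snd u)) ` set (takeWhile ?P (p # L)) = id ` set (takeWhile ?P (p # L))"
    by (intro image_cong) (simp_all only: id_apply)
  then have "Pair (fst p) ` snd ` set (takeWhile ?P (p # L)) = set (takeWhile ?P (p # L))"
    by (simp only: image_image image_id id_apply)
  then have "set (reorder_blocks (p # L)) = set (takeWhile ?P (p # L)) \<union> set (dropWhile ?P (p # L))"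
    using 2 by (simp only: reorder_blocks.simps set_append set_map set_rev set_sort)
  also have "\<dots> = set (p # L)" by (metis set_append takeWhile_dropWhile_id)
  finally show ?case .
qed simp

lemma sorted_reorder_blocks:
  "sorted (map fst L) \<Longrightarrow> sorted_wrt burge_less (reorder_blocks L)"
proof (induction L rule: reorder_blocks.induct)
  case (2 p L)
  let ?P = "\<lambda>u. fst u = fst p"
  let ?D = "dropWhile ?P (p # L)"
  have S: "sorted (map fst ?D)"
    using 2(2) by (metis dropWhile_eq_drop drop_map sorted_wrt_drop)
  \<comment> \<open>The first column after the block has a different top entry, so sortedness makes
    it and all later ones strictly larger.\<close>
  have "fst p < fst u" if "u \<in> set ?D" for u
  proof -
    have ne: "?D \<noteq> []" using that by (metis empty_iff empty_set)
    have "fst (hd ?D) \<noteq> fst p" using hd_dropWhile[OF ne] .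
    moreover have "hd ?D \<in> set (p # L)" using ne by (metis hd_in_set set_dropWhileD)
    ultimately have "fst p < fst (hd ?D)" using 2(2) by fastforce
    moreover have "fst (hd ?D) \<le> fst u"
      using S that ne by (cases ?D) auto
    ultimately show ?thesis by simp
  qed
  then have "\<forall>u\<in>set (map (Pair (fst p)) xs). \<forall>v\<in>set (reorder_blocks ?D). burge_less u v" for xs
    unfolding set_reorder_blocks by (simp add: burge_less_def)
  moreover have "sorted_wrt burge_less (map (Pair (fst p)) (rev (sort xs)))" for xs
    by (simp add: sorted_wrt_map burge_less_def sorted_wrt_rev)
  ultimately show ?case
    using 2(1)[OF S] unfolding reorder_blocks.simps sorted_wrt_append by blast
qed simp

lemma dual_Burge_reorder:
  assumes "sorted (map fst L)" "\<forall>(i, j)\<in>set L. i \<in> {1..q} \<and> j \<in> {1..q} \<and> j \<le> i"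
  shows "dual_Burge q (reorder_blocks L)"
  unfolding dual_Burge_def
proof (intro conjI allI impI)
  show "\<forall>(i, j)\<in>set (reorder_blocks L). i \<in> {1..q} \<and> j \<in> {1..q} \<and> j \<le> i"
    using assms(2) by (simp add: set_reorder_blocks)
  fix k assume "Suc k < length (reorder_blocks L)"
  then have "burge_less (reorder_blocks L ! k) (reorder_blocks L ! Suc k)"
    using sorted_wrt_nth_less[OF sorted_reorder_blocks[OF assms(1)], of k "Suc k"] by simp
  then show "fst (reorder_blocks L ! k) \<le> fst (reorder_blocks L ! Suc k)"
    and "fst (reorder_blocks L ! k) = fst (reorder_blocks L ! Suc k) \<Longrightarrow>
      snd (reorder_blocks L ! Suc k) \<le> snd (reorder_blocks L ! k)"
    by (auto simp: burge_less_def)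
qed

section \<open>The correspondence\<close>

text \<open>Inside a block the decrease is sharpened to a strict one on uncircled letters, the form
  that \<open>second_insertion\<close> takes as its premise.\<close>

definition column_order :: "nat \<times> letter \<Rightarrow> nat \<times> letter \<Rightarrow> bool" where
  "column_order u v \<longleftrightarrow> fst u \<le> fst v \<and> (fst u = fst v \<longrightarrow> col_ok (snd v) (snd u))"

lemma successively_nthI:
  "(\<And>k. Suc k < length xs \<Longrightarrow> R (xs ! k) (xs ! Suc k)) \<Longrightarrow> successively R xs"
proof (induction xs)
  case (Cons x xs)
  have "successively R xs" by (rule Cons.IH) (use Cons.prems[of "Suc k" for k] in simp)
  moreover have "R x (hd xs)" if "xs \<noteq> []" using Cons.prems[of 0] that by (simp add: hd_conv_nth)
  ultimately show ?case by (auto simp: successively_Cons)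
qed simp

lemma count_list_adjacent:
  assumes "Suc k < length w" "w ! k = w ! Suc k"
  shows "2 \<le> count_list w (w ! k)"
proof -
  have "w = take k w @ w ! k # w ! Suc k # drop (Suc (Suc k)) w"
    using assms(1) by (metis Cons_nth_drop_Suc Suc_lessD id_take_nth_drop)
  then have "count_list w (w ! k) = count_list (take k w @ w ! k # w ! Suc k # drop (Suc (Suc k)) w) (w ! k)"
    by metis
  then show ?thesis using assms(2) by simp
qed

text \<open>If \<open>col_ok\<close> failed inside a block, two neighbouring columns would coincide
  with an uncircled bottom letter and be counted twice.\<close>

lemma two_line_arrays_successively:
  assumes "w \<in> two_line_arrays m n q"
  shows "successively column_order w"
proof (rule successively_nthI)
  fix k assume k: "Suc k < length w"
  have chain: "fst (w ! k) \<le> fst (w ! Suc k)"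
      "fst (w ! k) = fst (w ! Suc k) \<Longrightarrow> snd (w ! Suc k) \<le> snd (w ! k)"
    and count: "\<And>i j. j \<in> B0 m \<Longrightarrow> count_list w (i, j) \<le> 1"
    and "\<forall>u\<in>set w. snd u \<in> B0 m \<union> B1 n"
    using assms k by (auto simp: two_line_arrays_def split_beta)
  then have mem: "snd (w ! k) \<in> B0 m \<union> B1 n" using k nth_mem[of k w] by simp
  have "col_ok (snd (w ! Suc k)) (snd (w ! k))" if eq: "fst (w ! k) = fst (w ! Suc k)"
  proof (rule ccontr)
    assume "\<not> ?thesis"
    then have s: "snd (w ! Suc k) = snd (w ! k)" "\<not> is_Circ (snd (w ! k))"
      using chain(2)[OF eq] by (auto simp: col_ok_def)
    then have "w ! k = w ! Suc k" using eq by (simp add: prod_eq_iff)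
    moreover have "count_list w (w ! k) \<le> 1"
      using count[of "snd (w ! k)" "fst (w ! k)"] B0_iff[OF mem] s(2) by simp
    ultimately show False using count_list_adjacent[OF k] by simp
  qed
  with chain(1) show "column_order (w ! k) (w ! Suc k)" by (simp add: column_order_def)
qed

text \<open>As \<open>i\<close> is maximal and the new box is a corner, only strictness in row
  \<open>k\<close> could fail, and the last premise excludes that.\<close>

lemma strict_filling_extend:
  assumes P: "strict_filling P" and Y: "young (insert (k, c) (dom P))" and new: "(k, c) \<notin> dom P"
    and le: "\<forall>x\<in>ran P. x \<le> i" and fresh: "\<And>d. P (k, d) \<noteq> Some i"
  shows "strict_filling (P((k, c) \<mapsto> i))"
proof -
  have YP: "young (dom P)" and F: "filled (<) (\<le>) P" using P by (auto simp: strict_filling_def)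
  have le': "P b = Some a \<Longrightarrow> a \<le> i" for a b using le by (blast intro: ranI)
  have out: "(k, c) \<in> dom P" if "(p, d) \<in> dom P" "k \<le> p" "c \<le> d" for p d
    using young_down[OF YP that(1)] young_pos[OF Y, of k c] that by auto
  have "filled (<) (\<le>) (P((k, c) \<mapsto> i))"
  proof (rule filled_update[OF F])
    fix d a assume "P (k, d) = Some a"
    then have "a \<noteq> i" "a \<le> i" using fresh le' by auto
    then show "a < i" by simp
  next
    fix d a assume "P (k, d) = Some a" "c < d"
    then show "i < a" using out[of k d] new by auto
  next
    fix p a assume "P (p, c) = Some a" "k < p"
    then show "i \<le> a" using out[of p c] new by auto
  qed (rule le')
  then show ?thesis using Y by (simp add: strict_filling_def)
qed

text \<open>The last clause makes the next entry equal to \<open>fst u\<close> the only one in its row, because the next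
  box of the same block is added strictly below row \<open>k\<close>.\<close>

definition last_step :: "letter set \<Rightarrow> nat \<times> letter \<Rightarrow> letter filling \<Rightarrow> nat filling \<Rightarrow> bool" where
  "last_step A u T P \<longleftrightarrow> (\<exists>T0 res. spo_filling A T0 \<and> snd u \<in> A \<and> insertion_ends T0 1 (snd u) res \<and>
     T = spo_insert T0 (snd u) \<and>
     (\<forall>k. res = Some k \<longrightarrow> (\<forall>r c. P (r, c) = Some (fst u) \<longrightarrow> r \<le> k)))"

text \<open>\<open>i\<close> is the top entry of the last column read. Only the top entries of
  \<open>L\<close> are kept sorted, since the bottom ones are ordered by the final
  reordering.\<close>

fun correspondence_invariant ::
  "letter set \<Rightarrow> nat \<Rightarrow> letter filling \<times> nat filling \<times> (nat \<times> nat) list \<Rightarrow> bool" where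
  "correspondence_invariant A i (T, P, L) \<longleftrightarrow>
     spo_filling A T \<and> strict_filling P \<and> dom P = dom T \<and> ran P \<subseteq> {1..i} \<and>
     sorted (map fst L) \<and> (\<forall>(i', j)\<in>set L. i' \<le> i \<and> 1 \<le> j \<and> j \<le> i')"

lemma ready_first:
  assumes "spo_filling A T" "z \<in> A" "A = B0 m \<union> B1 n"
  shows "ready A T 1 z"
  using assms by (auto simp: ready_def B0_def B1_def less_eq_letter_def less_letter_def)

text \<open>Entries of \<open>P\<close> are at most \<open>fst u\<close>, so an occurrence of
  \<open>fst v\<close> puts both columns into one block; by \<open>second_insertion\<close> the
  earlier step then added its box in a row above \<open>k\<close>.\<close>

lemma last_step_fresh:
  assumes A: "A = B0 m \<union> B1 n" and last: "last_step A u T P" and ord: "column_order u v"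
    and v: "snd v \<in> A" and le: "\<forall>x\<in>ran P. x \<le> fst u"
    and ends: "insertion_ends T 1 (snd v) (Some k)" and entry: "P (r, c) = Some (fst v)"
  shows "r < k"
proof -
  have "fst v \<le> fst u" using le entry by (blast intro: ranI)
  then have eq: "fst u = fst v" and col: "col_ok (snd v) (snd u)"
    using ord by (auto simp: column_order_def)
  from last obtain T0 res where T0: "spo_filling A T0" "snd u \<in> A" "insertion_ends T0 1 (snd u) res"
    "T = spo_insert T0 (snd u)" and rows: "\<And>k r c. res = Some k \<Longrightarrow> P (r, c) = Some (fst u) \<Longrightarrow> r \<le> k"
    unfolding last_step_def by blast
  have "Plain 1 \<le> snd v" using v A by (auto simp: B0_def B1_def less_eq_letter_def less_letter_def)
  then obtain k' where "res = Some k'" "k' < k"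
    using second_insertion[OF T0(3) ready_first[OF T0(1,2) A] col _ _ ends] T0(4)
    by (auto simp: spo_insert_def)
  then show ?thesis using rows entry eq by fastforce
qed

text \<open>The premise \<open>fresh\<close> stays outside the invariant because it concerns the
  letter about to be inserted; it comes from the preceding step, or from \<open>P\<close> being
  empty at the start.\<close>

lemma correspondence_step_invariant:
  assumes A: "A = B0 m \<union> B1 n" and inv: "correspondence_invariant A i (T, P, L)"
    and v: "v = (i', j)" "i \<le> i'" "1 \<le> i'" "j \<in> A"
    and fresh: "\<And>k r c. insertion_ends T 1 j (Some k) \<Longrightarrow> P (r, c) = Some i' \<Longrightarrow> r < k"
    and step: "correspondence_step v (T, P, L) = (T', P', L')"
  shows "correspondence_invariant A i' (T', P', L') \<and> last_step A v T' P'"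
proof -
  have T: "spo_filling A T" and P: "strict_filling P" and dom: "dom P = dom T"
    and ran: "ran P \<subseteq> {1..i}" and L: "sorted (map fst L)" "\<forall>(i', j)\<in>set L. i' \<le> i \<and> 1 \<le> j \<and> j \<le> i'"
    using inv by auto
  have Y: "young (dom T)" using T by (simp add: spo_filling_def)
  obtain res where res: "insertion_ends T 1 j res"
    using insertion_ends_exists[OF young_finite[OF Y]] by blast
  have rdy: "ready A T 1 j" by (rule ready_first[OF T v(4) A])
  have ranP: "\<forall>x\<in>ran P. x \<le> i'" using ran v(2) by force
  define T1 where "T1 = spo_insert T j"
  have result: "spo_filling A T1"
    "case res of None \<Rightarrow> \<exists>b\<in>dom T. dom T1 = dom T - {b}
     | Some k \<Rightarrow> \<exists>c. (k, c) \<notin> dom T \<and> dom T1 = insert (k, c) (dom T)"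
    using insertion_result[OF res rdy] unfolding T1_def spo_insert_def by blast+
  have Y1: "young (dom T1)" using result(1) by (simp add: spo_filling_def)
  show ?thesis
  proof (cases res)
    case (Some k)
    then obtain c where c: "(k, c) \<notin> dom T" "dom T1 = insert (k, c) (dom T)" using result(2) by auto
    then have "dom T \<subset> dom T1" "the_elem (dom T1 - dom T) = (k, c)" by (auto simp: insert_Diff_if)
    then have out: "T' = T1" "P' = P((k, c) \<mapsto> i')" "L' = L"
      using step v(1) by (simp_all add: T1_def Let_def)
    have new: "P (k, d) \<noteq> Some i'" for d using fresh[of k k d] res Some by auto
    have "strict_filling P'" unfolding out
      by (rule strict_filling_extend[OF P _ _ ranP new]) (use c dom Y1 in simp_all)
    moreover have "dom P' = dom T'" using c dom out by simp
    moreover have "ran P' \<subseteq> {1..i'}" 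
      using ran_map_upd[of P "(k, c)" i'] c(1) dom ran v(2,3) out by (fastforce simp: domIff)
    \<comment> \<open>Older copies of \<open>i'\<close> lie above row \<open>k\<close> by
      \<open>fresh\<close>, and the new one lies in row \<open>k\<close>.\<close>
    moreover have "last_step A v T' P'"
      unfolding last_step_def using T v(1,4) res out fresh Some
      by (intro exI[of _ T] exI[of _ res]) (auto simp: T1_def less_imp_le)
    moreover have "\<forall>(a, b)\<in>set L'. a \<le> i' \<and> 1 \<le> b \<and> b \<le> a" using L(2) v(2) out by fastforce
    ultimately show ?thesis using result(1) out L(1) by simp
  next
    case None
    then obtain b where b: "b \<in> dom T" "dom T1 = dom T - {b}" using result(2) by auto
    then have "\<not> dom T \<subset> dom T1" "the_elem (dom T - dom T1) = b" by (auto simp: double_diff)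
    moreover obtain P1 a where P1: "reverse_dual_row_insert P b = (P1, a)" by fastforce
    ultimately have out: "T' = T1" "P' = P1" "L' = L @ [(i', a)]"
      using step v(1) by (simp_all add: T1_def Let_def)
    have rev: "strict_filling P1" "dom P1 = dom P - {b}" "ran P1 \<subseteq> ran P" "a \<in> ran P"
      using reverse_dual_row_insert_result[OF P _ _ P1] b dom Y1 by auto
    have "sorted (map fst L')" using L v(2) out by (fastforce simp: sorted_append)
    moreover have "\<forall>(c, d)\<in>set L'. c \<le> i' \<and> 1 \<le> d \<and> d \<le> c"
      using L(2) v(2) rev(4) ran out by fastforce
    \<comment> \<open>After a cancellation the row clause is vacuous; an addition by the next column
      of the same block is ruled out by \<open>second_insertion\<close>.\<close>
    moreover have "last_step A v T' P'"
      unfolding last_step_def using T v(1,4) res out None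
      by (intro exI[of _ T] exI[of _ res]) (auto simp: T1_def)
    moreover have "ran P' \<subseteq> {1..i'}" using rev(3) ran v(2) out by force
    ultimately show ?thesis using result(1) out rev b dom by simp
  qed
qed

text \<open>The default 0 for the empty array gives the empty range \<open>{1..0}\<close> and lies
  below every top entry.\<close>

lemma correspondence_fold_invariant:
  assumes A: "A = B0 m \<union> B1 n" and "successively column_order w"
    and "\<forall>(i, j)\<in>set w. i \<in> {1..q} \<and> j \<in> A"
    and "fold correspondence_step w (Map.empty, Map.empty, []) = (T, P, L)"
  shows "correspondence_invariant A (if w = [] then 0 else fst (last w)) (T, P, L) \<and>
    (w \<noteq> [] \<longrightarrow> last_step A (last w) T P)"
  using assms(2-4)
proof (induction w arbitrary: T P L rule: rev_induct)
  case Nil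
  have "young {}" by (simp add: young_def)
  then show ?case
    using Nil by (auto simp: spo_filling_def spo_entries_def strict_filling_def filled_iff)
next
  case (snoc v w)
  obtain T0 P0 L0 where w: "fold correspondence_step w (Map.empty, Map.empty, []) = (T0, P0, L0)"
    using prod_cases3 by blast
  have IH: "correspondence_invariant A (if w = [] then 0 else fst (last w)) (T0, P0, L0)"
    "w \<noteq> [] \<Longrightarrow> last_step A (last w) T0 P0"
    using snoc.IH[OF _ _ w] snoc.prems(1,2) by (auto simp: successively_append_iff)
  have ord: "column_order (last w) v" if "w \<noteq> []"
    using snoc.prems(1) that by (simp add: successively_append_iff)
  obtain i j where v: "v = (i, j)" by fastforce
  have ij: "1 \<le> i" "j \<in> A" using snoc.prems(2) v by auto
  have step: "correspondence_step v (T0, P0, L0) = (T, P, L)"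
    using snoc.prems(3) w by simp
  have "r < k" if "insertion_ends T0 1 j (Some k)" "P0 (r, c) = Some i" for k r c
  proof (cases "w = []")
    case True
    then have "P0 = Map.empty" using w by simp
    then show ?thesis using that by simp
  next
    case False
    then have "\<forall>x\<in>ran P0. x \<le> fst (last w)" using IH(1) by fastforce
    from last_step_fresh[OF A IH(2)[OF False] ord[OF False] _ this] show ?thesis
      using v ij that by simp
  qed
  moreover have "(if w = [] then 0 else fst (last w)) \<le> i"
    using ord v by (simp add: column_order_def)
  ultimately have "correspondence_invariant A i (T, P, L) \<and> last_step A v T P"
    using correspondence_step_invariant[OF A IH(1) v _ ij _ step] by blast
  then show ?case using v by simp
qed

theorem theorem5p4:
  fixes m n q :: nat
    and \<pi> :: "(nat \<times> letter) list"
    and Pt :: "letter filling" and PT :: "nat filling" and L :: "(nat \<times> nat) list"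
  assumes "1 \<le> m" and "1 \<le> n" and "1 \<le> q"
    and "\<pi> \<in> two_line_arrays m n q"
    and "dual_spo_correspondence \<pi> = (Pt, PT, L)"
  shows "(\<exists>lam. spo_tableau m n lam Pt \<and>
            semistandard_tableau (conjugate lam) PT \<and> ran PT \<subseteq> {1..q}) \<and>
         dual_Burge q L"
proof -
  let ?A = "B0 m \<union> B1 n"
  obtain T P L0 where fold: "fold correspondence_step \<pi> (Map.empty, Map.empty, []) = (T, P, L0)"
    using prod_cases3 by blast
  then have out: "Pt = T" "PT = transpose_filling P" "L = reorder_blocks L0"
    using assms(5) by (auto simp: dual_spo_correspondence_def)
  have mem: "\<forall>(i, j)\<in>set \<pi>. i \<in> {1..q} \<and> j \<in> ?A"
    using assms(4) by (auto simp: two_line_arrays_def)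
  define i where "i = (if \<pi> = [] then 0 else fst (last \<pi>))"
  have "i \<le> q" using mem last_in_set[of \<pi>] by (fastforce simp: i_def)
  have inv: "correspondence_invariant ?A i (T, P, L0)"
    using correspondence_fold_invariant[OF refl two_line_arrays_successively[OF assms(4)] mem fold]
    unfolding i_def by blast
  then have T: "spo_filling ?A T" and P: "strict_filling P" and dom: "dom P = dom T"
    and ran: "ran P \<subseteq> {1..i}" and L0: "sorted (map fst L0)" "\<forall>(i', j)\<in>set L0. i' \<le> i \<and> 1 \<le> j \<and> j \<le> i'"
    by auto
  obtain lam where lam: "is_partition lam" "diagram lam = dom T"
    using young_partition T unfolding spo_filling_def by blast
  have "spo_tableau m n lam Pt" unfolding out by (rule spo_filling_tableau[OF T lam])
  moreover have "semistandard_tableau (conjugate lam) PT" "ran PT \<subseteq> {1..q}"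
    using strict_filling_transpose[OF P lam(1)] lam(2) dom ran \<open>i \<le> q\<close> unfolding out by auto
  moreover have "dual_Burge q L"
    unfolding out by (rule dual_Burge_reorder[OF L0(1)]) (use L0(2) \<open>i \<le> q\<close> in fastforce)
  ultimately show ?thesis by blast
qed

end
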